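(* There exist universal constants $C_0,c>0$ such that the following holds. Let $\mathbb{K}\in\{\mathbb{R},\mathbb{C}\}$ and let $\tilde A=A+E$ with $A,E\in\mathbb{K}^{m\times n}$, where $A$ is nonzero with stable rank $r=\|A\|_F^2/\|A\|_2^2$ and rank $k$. Let $$\alpha=\frac1{\sqrt m}\min\Big\{\frac{\|A\|_F}{\|A(i,:)\|_2}:A(i,:)\ne0\Big\},\qquad \beta=\frac1{\sqrt n}\min\Big\{\frac{\|A\|_F}{\|A(:,j)\|_2}:A(:,j)\ne0\Big\}.$$ Let $\varepsilon,\delta\in(0,1)$ be such that $\frac{\varepsilon^2\sqrt\delta}{2}<\min\{\alpha,\beta\}$ and $\varepsilon<\frac{\sigma_k(A)}{\|A\|_2}$. Let $d_1,d_2$ be positive integers with $d_1,d_2\ge C_0\big(\frac{r}{\varepsilon^4\delta}\big)\log\big(\frac{r}{\varepsilon^4\delta}\big)$. Sample $d_1$ rows of $\tilde A$ uniformly with replacement, giving the index list $I$, and, independently, $d_2$ columns of $\tilde A$ uniformly with replacement, giving the index list $J$, so that $\tilde C=\tilde A(:,J)$, $\tilde R=\tilde A(I,:)$, $\tilde U=\tilde A(I,J)$; let $C=A(:,J)$, $R=A(I,:)$, $U=A(I,J)$ be the corresponding submatrices of $A$. Then with probability at least $$\big(1-2\exp(-c\alpha^2/\delta)\big)\big(1-2\exp(-c\beta^2/\delta)\big),$$ which is at least $\big(1-2\exp(-c\varepsilon^4)\big)^2$, one has $$\operatorname{rank}(U)=k\quad\text{and}\quad A=CU^\dagger R.$$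
   Context: $\|\cdot\|_2$ is the spectral norm of a matrix (Euclidean norm of a vector), $\|\cdot\|_F$ the Frobenius norm, $\sigma_1(A)\ge\sigma_2(A)\ge\cdots$ the singular values, and $U^\dagger$ the Moore--Penrose pseudoinverse. $A(i,:)$ and $A(:,j)$ are the $i$-th row and $j$-th column of $A$. For index lists $I=(i_1,\dots,i_{d_1})$, $J=(j_1,\dots,j_{d_2})$ (possibly with repetitions), $A(I,:)$ has $a$-th row $A(i_a,:)$, $A(:,J)$ has $b$-th column $A(:,j_b)$, and $A(I,J)$ has $(a,b)$ entry $A_{i_a,j_b}$; likewise for $\tilde A$. Sampling uniformly with replacement means each index is drawn independently and uniformly from $\{1,\dots,m\}$ (rows) or $\{1,\dots,n\}$ (columns).
   Formalization: Each factor 1-2exp(-t), in the probability bound and in the bound (1-2exp(-cε⁴))², is replaced by max(0, 1-2exp(-t)); literally, two negative factors give a positive product and the claim is false. For the constant c obtained, the last bound is then 0. *)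

theory Defs
  imports "HOL-Probability.Probability" "Jordan_Normal_Form.DL_Rank"
    "Jordan_Normal_Form.Schur_Decomposition"
begin

text \<open>
  The dimensions are quantified below the universal constants, so matrices are those of
  \<^theory>\<open>Jordan_Normal_Form.Matrix\<close>, with explicit carriers. Their indices start at 0.
  The clashing constants and notation of HOL-Analysis for type-indexed matrices are hidden.
\<close>

hide_type (open) Finite_Cartesian_Product.vec
hide_const (open) Finite_Cartesian_Product.vec Finite_Cartesian_Product.mat
  Finite_Cartesian_Product.row Finite_Cartesian_Product.rows Finite_Cartesian_Product.vec_nth
no_notation Finite_Cartesian_Product.vec_nth (infixl "$" 90)

definition vec_norm2 :: "'a :: real_normed_vector vec \<Rightarrow> real" where
  "vec_norm2 v = L2_set (\<lambda>i. norm (v $ i)) {..<dim_vec v}"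

definition frob_norm :: "'a :: real_normed_vector mat \<Rightarrow> real" where
  "frob_norm A = L2_set (\<lambda>(i, j). norm (A $$ (i, j))) ({..<dim_row A} \<times> {..<dim_col A})"

definition spectral_norm :: "'a :: {real_normed_vector, semiring_0} mat \<Rightarrow> real" where
  "spectral_norm A =
     (SUP v \<in> {v \<in> carrier_vec (dim_col A). vec_norm2 v \<le> 1}. vec_norm2 (A *\<^sub>v v))"

text \<open>
  Singular values in decreasing order, with multiplicity: the square roots of the eigenvalues of
  \<open>A\<^sup>* A\<close>. These eigenvalues are nonnegative reals, so \<^const>\<open>norm\<close> merely
  turns them into elements of \<^typ>\<open>real\<close> (over the complex field), and over the real field the
  characteristic polynomial splits, so no eigenvalue is lost. The list has length
  \<^term>\<open>dim_col A\<close>; entries beyond the smaller dimension are 0.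
\<close>

definition singular_values :: "'a :: {conjugatable_field, real_normed_field} mat \<Rightarrow> real list" where
  "singular_values A = rev (sorted_list_of_multiset
     (image_mset (\<lambda>l. sqrt (norm l)) (proots (char_poly (mat_adjoint A * A)))))"

text \<open>Numbered from 1, so \<open>singular_value A 1\<close> is the largest one.\<close>

definition singular_value :: "'a :: {conjugatable_field, real_normed_field} mat \<Rightarrow> nat \<Rightarrow> real" where
  "singular_value A i = singular_values A ! (i - 1)"

definition is_pseudoinverse :: "'a :: conjugatable_field mat \<Rightarrow> 'a mat \<Rightarrow> bool" where
  "is_pseudoinverse A X \<longleftrightarrow>
     X \<in> carrier_mat (dim_col A) (dim_row A) \<and>
     A * X * A = A \<and> X * A * X = X \<and>
     mat_adjoint (A * X) = A * X \<and> mat_adjoint (X * A) = X * A"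

text \<open>
  Over the real and the complex field exactly one matrix satisfies the four Penrose conditions.
\<close>

definition pseudoinverse :: "'a :: conjugatable_field mat \<Rightarrow> 'a mat" where
  "pseudoinverse A = (THE X. is_pseudoinverse A X)"

text \<open>
  Submatrices given by index lists, in the order of the lists and with repetitions
  (unlike \<open>submatrix\<close>, which takes index sets).
\<close>

definition sub_rows :: "'a mat \<Rightarrow> nat list \<Rightarrow> 'a mat" where
  "sub_rows A I = mat (length I) (dim_col A) (\<lambda>(a, j). A $$ (I ! a, j))"

definition sub_cols :: "'a mat \<Rightarrow> nat list \<Rightarrow> 'a mat" where
  "sub_cols A J = mat (dim_row A) (length J) (\<lambda>(i, b). A $$ (i, J ! b))"

definition sub_mat :: "'a mat \<Rightarrow> nat list \<Rightarrow> nat list \<Rightarrow> 'a mat" where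
  "sub_mat A I J = mat (length I) (length J) (\<lambda>(a, b). A $$ (I ! a, J ! b))"

text \<open>
  Two independent index lists, of lengths \<open>d\<^sub>1\<close> and \<open>d\<^sub>2\<close>, of independent uniform draws from the
  row indices \<open>{..<m}\<close> and the column indices \<open>{..<n}\<close>.
\<close>

definition sample_indices :: "nat \<Rightarrow> nat \<Rightarrow> nat \<Rightarrow> nat \<Rightarrow> (nat list \<times> nat list) pmf" where
  "sample_indices m n d\<^sub>1 d\<^sub>2 =
     pair_pmf (replicate_pmf d\<^sub>1 (pmf_of_set {..<m})) (replicate_pmf d\<^sub>2 (pmf_of_set {..<n}))"

text \<open>
  Lower bounds \<open>1 - 2 * exp (- t)\<close> on probabilities are used below in the form
  \<open>max 0 (1 - 2 * exp (- t))\<close>. A negative lower bound is void, and the product of two void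
  bounds must not become a positive one: without the truncation the bound is false when both
  factors are negative.
\<close>

end

theory Submission
  imports Defs "HOL-Probability.Product_PMF"
begin

text \<open>
  Write \<open>A = B Q\<^sup>*\<close> with \<open>Q\<close> an isometry with \<open>k\<close> columns and \<open>B\<^sup>* B\<close> the diagonal matrix of the squared
  nonzero singular values. Then \<open>U = B(I,:) Q(J,:)\<^sup>*\<close>, and as soon as both factors are injective,
  \<open>U\<close> has rank \<open>k\<close> and its pseudoinverse is explicit, so that \<open>C U\<^sup>\<dagger> R = A\<close> by cancellation.
  The two events are independent, and the second one is the first one for \<open>A\<^sup>*\<close>.

  Injectivity of \<open>B(I,:)\<close> is a coupon collector problem and needs no matrix concentration. Suppose the rows
  sampled so far leave a kernel of dimension \<open>j\<close>. On that kernel \<open>B\<close> has squared Frobenius norm at least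
  \<open>j \<sigma>\<^sub>k\<^sup>2\<close>, while each of its \<open>m\<close> rows contributes at most \<open>\<parallel>A\<parallel>\<^sub>F\<^sup>2 / (m \<alpha>\<^sup>2)\<close>, so the next row lowers \<open>j\<close> with
  probability at least \<open>j q\<close>, where \<open>q = \<alpha>\<^sup>2 \<sigma>\<^sub>k\<^sup>2 / \<parallel>A\<parallel>\<^sub>F\<^sup>2\<close>. Hence the expected dimension after \<open>d\<close> draws is at most
  \<open>k exp (- q d)\<close>, which bounds the failure probability. With \<open>c = ln 2 / 3\<close> the claimed bound is void unless
  \<open>\<alpha>\<^sup>2 / \<delta> > 3\<close>, and in that case the sample size absorbs the factor \<open>k \<le> r / \<epsilon>\<^sup>2\<close>.
\<close>

section \<open>Norms, adjoints and unitary completion\<close>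

text \<open>Common ground of the real and the complex field, so that the argument is carried out
  once. The axiom ties \<open>conjugate\<close> to \<open>norm\<close>;
  \<open>mult_conjugate\<close> restates it with \<open>of_real\<close>.\<close>

class rc_field = conjugatable_ordered_field + real_normed_field +
  assumes mult_conjugate_scaleR: "x * conjugate x = (norm x)\<^sup>2 *\<^sub>R 1"

instance real :: rc_field
  by standard (simp add: power2_eq_square)

instance complex :: rc_field
  by standard (simp only: complex_norm_square scaleR_conv_of_real conjugate_complex_def mult_1_right)

lemma mult_conjugate: "x * conjugate x = of_real ((norm (x :: 'a :: rc_field))\<^sup>2)"
  by (simp add: mult_conjugate_scaleR of_real_def)

text \<open>For nonzero r, both \<open>conjugate (of_real r)\<close> and \<open>of_real r\<close>
  give the squared norm when multiplied by \<open>of_real r\<close>, and this factor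
  cancels.\<close>

lemma conjugate_of_real [simp]: "conjugate (of_real r) = (of_real r :: 'a :: rc_field)"
proof (cases "r = 0")
  case False
  have "(of_real r :: 'a) * conjugate (of_real r) = of_real r * of_real r"
    using mult_conjugate[of "of_real r :: 'a"] by (simp add: power2_eq_square)
  with False show ?thesis by simp
qed simp

lemma mat_adjoint_carrier [simp]: "A \<in> carrier_mat m n \<Longrightarrow> mat_adjoint A \<in> carrier_mat n m"
  by (auto simp: mat_adjoint_def mat_of_rows_def)

lemma mat_adjoint_dim [simp]: "dim_row (mat_adjoint A) = dim_col A" "dim_col (mat_adjoint A) = dim_row A"
  by (auto simp: mat_adjoint_def mat_of_rows_def)

lemma mat_adjoint_index [simp]:
  "i < dim_col A \<Longrightarrow> j < dim_row A \<Longrightarrow> mat_adjoint A $$ (i, j) = conjugate (A $$ (j, i))"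
  by (auto simp: mat_adjoint_def mat_of_rows_def)

lemma mat_adjoint_adjoint [simp]: "mat_adjoint (mat_adjoint A) = A"
  by (rule eq_matI) auto

lemma mat_adjoint_mult:
  assumes "A \<in> carrier_mat m n" "B \<in> carrier_mat n p"
  shows "mat_adjoint (A * B) = mat_adjoint B * mat_adjoint A"
  using assms
  by (intro eq_matI)
    (auto simp: scalar_prod_def sum_conjugate conjugate_dist_mul mult.commute intro!: sum.cong)

lemma mat_adjoint_one [simp]: "mat_adjoint (1\<^sub>m n :: 'a :: rc_field mat) = 1\<^sub>m n"
proof -
  have "conjugate (1 :: 'a) = 1" using conjugate_of_real[of 1, where 'a = 'a] by simp
  then show ?thesis by (intro eq_matI) auto
qed

lemma vec_norm2_nonneg [simp]: "0 \<le> vec_norm2 v"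
  by (simp add: vec_norm2_def)

lemma vec_norm2_sq: "(vec_norm2 v)\<^sup>2 = (\<Sum>i<dim_vec v. (norm (v $ i))\<^sup>2)"
  by (simp add: vec_norm2_def L2_set_def sum_nonneg)

lemma vec_norm2_eq_0_iff: "v \<in> carrier_vec n \<Longrightarrow> vec_norm2 v = 0 \<longleftrightarrow> v = 0\<^sub>v n"
  by (auto simp: vec_norm2_def L2_set_eq_0_iff intro!: eq_vecI)

lemma cscalar_prod_self: "v \<bullet>c v = of_real ((vec_norm2 (v :: 'a :: rc_field vec))\<^sup>2)"
  by (auto simp: vec_norm2_sq scalar_prod_def mult_conjugate atLeast0LessThan simp flip: of_real_power)

lemma cscalar_prod_adjoint:
  assumes "A \<in> carrier_mat m n" "v \<in> carrier_vec n" "w \<in> carrier_vec m"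
  shows "(A *\<^sub>v v) \<bullet>c w = v \<bullet>c (mat_adjoint A *\<^sub>v w)"
proof -
  have "(A *\<^sub>v v) \<bullet>c w = (\<Sum>i<m. \<Sum>j<n. A $$ (i, j) * v $ j * conjugate (w $ i))"
    using assms by (auto simp: scalar_prod_def atLeast0LessThan sum_distrib_right intro!: sum.cong)
  also have "\<dots> = (\<Sum>j<n. \<Sum>i<m. A $$ (i, j) * v $ j * conjugate (w $ i))"
    by (rule sum.swap)
  also have "\<dots> = v \<bullet>c (mat_adjoint A *\<^sub>v w)"
    using assms by (auto simp: scalar_prod_def atLeast0LessThan sum_distrib_left sum_conjugate
        conjugate_dist_mul mult.commute mult.left_commute intro!: sum.cong)
  finally show ?thesis .
qed

text \<open>Moving one factor across the inner product. Through this identity, facts about the Gram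
  matrix \<open>mat_adjoint A * A\<close> become facts about lengths.\<close>

lemma vec_norm2_mult_mat:
  fixes A :: "'a :: rc_field mat"
  assumes "A \<in> carrier_mat m n" "v \<in> carrier_vec n"
  shows "of_real ((vec_norm2 (A *\<^sub>v v))\<^sup>2) = v \<bullet>c ((mat_adjoint A * A) *\<^sub>v v)"
proof -
  have "of_real ((vec_norm2 (A *\<^sub>v v))\<^sup>2) = (A *\<^sub>v v) \<bullet>c (A *\<^sub>v v)"
    by (simp only: cscalar_prod_self)
  also have "\<dots> = v \<bullet>c (mat_adjoint A *\<^sub>v (A *\<^sub>v v))"
    using assms by (intro cscalar_prod_adjoint) auto
  also have "mat_adjoint A *\<^sub>v (A *\<^sub>v v) = (mat_adjoint A * A) *\<^sub>v v"
    using assms by (intro assoc_mult_mat_vec[symmetric, of _ n m _ n]) auto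
  finally show ?thesis .
qed

lemma vec_norm2_isometry:
  fixes Q :: "'a :: rc_field mat"
  assumes Q: "Q \<in> carrier_mat n k" "mat_adjoint Q * Q = 1\<^sub>m k" and v: "v \<in> carrier_vec k"
  shows "vec_norm2 (Q *\<^sub>v v) = vec_norm2 v"
proof -
  have "(of_real ((vec_norm2 (Q *\<^sub>v v))\<^sup>2) :: 'a) = of_real ((vec_norm2 v)\<^sup>2)"
    unfolding vec_norm2_mult_mat[OF Q(1) v] Q(2) using v by (simp add: cscalar_prod_self)
  then show ?thesis by (metis of_real_eq_iff vec_norm2_nonneg power2_eq_iff_nonneg)
qed

lemma row_norm_mult_adjoint:
  fixes A :: "'a :: rc_field mat"
  assumes "A \<in> carrier_mat m n" "i < m"
  shows "(A * mat_adjoint A) $$ (i, i) = of_real ((vec_norm2 (row A i))\<^sup>2)"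
  using assms by (auto simp: scalar_prod_def vec_norm2_sq mult_conjugate atLeast0LessThan intro!: sum.cong)

lemma col_norm_adjoint_mult:
  fixes A :: "'a :: rc_field mat"
  assumes "A \<in> carrier_mat m n" "i < n"
  shows "(mat_adjoint A * A) $$ (i, i) = of_real ((vec_norm2 (col A i))\<^sup>2)"
  using assms
  by (auto simp: scalar_prod_def vec_norm2_sq mult_conjugate mult.commute[of "conjugate _"] atLeast0LessThan intro!: sum.cong)

text \<open>The squared row norms are the diagonal of the product with the adjoint. Hence they
  survive a change of orthonormal basis in the column coordinates, even when the number of columns
  changes.\<close>

lemma row_norm_cong:
  fixes A :: "'a :: rc_field mat"
  assumes "A \<in> carrier_mat m n" "B \<in> carrier_mat m k"
    "A * mat_adjoint A = B * mat_adjoint B" "i < m"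
  shows "vec_norm2 (row A i) = vec_norm2 (row B i)"
proof -
  have "(of_real ((vec_norm2 (row A i))\<^sup>2) :: 'a) = of_real ((vec_norm2 (row B i))\<^sup>2)"
    using assms row_norm_mult_adjoint by metis
  then show ?thesis by (metis of_real_eq_iff vec_norm2_nonneg power2_eq_iff_nonneg)
qed

lemma isometry_iff_cols:
  fixes Q :: "'a :: rc_field mat"
  assumes Q: "Q \<in> carrier_mat n k"
  shows "mat_adjoint Q * Q = 1\<^sub>m k \<longleftrightarrow>
    (\<forall>i<k. \<forall>j<k. col Q j \<bullet>c col Q i = (if i = j then 1 else 0))"
proof -
  have "(mat_adjoint Q * Q) $$ (i, j) = col Q j \<bullet>c col Q i" if "i < k" "j < k" for i j
    using Q that by (auto simp: scalar_prod_def mult.commute intro!: sum.cong)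
  then show ?thesis using Q by (auto simp: mat_eq_iff)
qed

lemma left_inverse_imp_right_inverse:
  fixes V :: "'a :: field mat"
  assumes "V \<in> carrier_mat n n" "W \<in> carrier_mat n n" "W * V = 1\<^sub>m n"
  shows "V * W = 1\<^sub>m n"
  using mat_mult_left_right_inverse[OF assms(2,1,3)] .

text \<open>Complete v to a basis, orthogonalise and normalise; Gram-Schmidt keeps the first vector.
  Only the direction of the first column matters later, so its scale stays an unspecified nonzero
  c.\<close>

lemma unitary_with_first_col:
  fixes v :: "'a :: rc_field vec"
  assumes v: "v \<in> carrier_vec n" and v0: "v \<noteq> 0\<^sub>v n"
  obtains W c where "W \<in> carrier_mat n n" "mat_adjoint W * W = 1\<^sub>m n" "W * mat_adjoint W = 1\<^sub>m n"
    "col W 0 = c \<cdot>\<^sub>v v" "c \<noteq> 0"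
proof -
  interpret cof_vec_space n "TYPE('a)" .
  define b where "b = basis_completion v"
  define ws where "ws = gram_schmidt n b"
  from basis_completion[OF v v0, folded b_def]
  have dist_b: "distinct b" and indep: "\<not> lin_dep (set b)" and b: "set b \<subseteq> carrier_vec n"
    and hdb: "hd b = v" and len_b: "length b = n" by auto
  have n: "n > 0" using v v0 by (cases n) auto
  from hdb len_b n obtain vs where bv: "b = v # vs" by (cases b, auto)
  from gram_schmidt_result[OF b dist_b indep refl, folded ws_def]
  have ws: "set ws \<subseteq> carrier_vec n" "corthogonal ws" "length ws = n" by (auto simp: len_b)
  from gram_schmidt_hd[OF v, of vs, folded bv] have hdws: "hd ws = v" unfolding ws_def .
  \<comment> \<open>Gram-Schmidt yields orthogonal vectors that need not have length 1; d holds the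
    reciprocals of their lengths.\<close>
  define d where "d = (\<lambda>i. of_real (inverse (vec_norm2 (ws ! i))) :: 'a)"
  define W where "W = mat n n (\<lambda>(i, j). d j * ws ! j $ i)"
  have W: "W \<in> carrier_mat n n" by (simp add: W_def)
  have wsi: "ws ! i \<in> carrier_vec n" if "i < n" for i using ws that by auto
  have colW: "col W i = d i \<cdot>\<^sub>v ws ! i" if "i < n" for i
    using wsi[OF that] that by (auto simp: W_def intro!: eq_vecI)
  have nz: "vec_norm2 (ws ! i) \<noteq> 0" if "i < n" for i
  proof -
    have "ws ! i \<bullet>c ws ! i \<noteq> 0" using corthogonalD[OF ws(2), of i i] ws(3) that by auto
    then show ?thesis by (auto simp: cscalar_prod_self)
  qed
  have "col W j \<bullet>c col W i = (if i = j then 1 else 0)" if ij: "i < n" "j < n" for i j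
  proof -
    have "col W j \<bullet>c col W i = d j * conjugate (d i) * (ws ! j \<bullet>c ws ! i)"
      using wsi[OF ij(1)] wsi[OF ij(2)] ij
      by (simp add: colW scalar_prod_def sum_distrib_left conjugate_dist_mul mult.commute mult.left_commute)
    also have "\<dots> = (if i = j then 1 else 0)"
    proof (cases "i = j")
      case True
      moreover have "conjugate (d j) = d j" by (simp only: d_def conjugate_of_real)
      ultimately show ?thesis using nz[OF ij(1)]
        by (simp add: cscalar_prod_self d_def power2_eq_square field_simps)
    next
      case False
      then show ?thesis using corthogonalD[OF ws(2), of j i] ws(3) ij by auto
    qed
    finally show ?thesis .
  qed
  then have iso: "mat_adjoint W * W = 1\<^sub>m n" using isometry_iff_cols[OF W] by auto
  show thesis
  proof (rule that[OF W iso _ , of "d 0"])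
    show "W * mat_adjoint W = 1\<^sub>m n" using left_inverse_imp_right_inverse[OF W _ iso] W by simp
    show "col W 0 = d 0 \<cdot>\<^sub>v v" using colW[OF n] hdws ws(3) n by (metis hd_conv_nth length_0_conv less_irrefl)
    show "d 0 \<noteq> 0" using nz[OF n] by (simp add: d_def)
  qed
qed

section \<open>Spectral theorem for hermitian matrices\<close>

lemma mat_adjoint_four_block_diag:
  fixes A :: "'a :: conjugatable_field mat"
  assumes "A \<in> carrier_mat a b" "D \<in> carrier_mat c d"
  shows "mat_adjoint (four_block_mat A (0\<^sub>m a d) (0\<^sub>m c b) D) =
    four_block_mat (mat_adjoint A) (0\<^sub>m b c) (0\<^sub>m d a) (mat_adjoint D)"
  using assms by (intro eq_matI) auto

lemma mult_four_block_diag: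
  fixes A :: "'a :: semiring_0 mat"
  assumes "A \<in> carrier_mat a b" "D \<in> carrier_mat c d" "A' \<in> carrier_mat b e" "D' \<in> carrier_mat d f"
  shows "four_block_mat A (0\<^sub>m a d) (0\<^sub>m c b) D * four_block_mat A' (0\<^sub>m b f) (0\<^sub>m d e) D' =
    four_block_mat (A * A') (0\<^sub>m a f) (0\<^sub>m c e) (D * D')"
  using assms by (subst mult_four_block_mat[of _ a b _ d _ c _ _ e _ f]) auto

text \<open>Deflation along the list of roots: an eigenvector for the head e becomes the first
  column of a unitary W, and conjugating by W splits off a 1 by 1 block e. The remaining block is
  again hermitian and has the remaining roots. The diagonal follows the order of \<open>es\<close>,
  so a sorted list of roots gives a sorted diagonal.\<close>

lemma hermitian_diagonalization:
  fixes M :: "'a :: rc_field mat"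
  assumes "M \<in> carrier_mat n n" "mat_adjoint M = M" "char_poly M = (\<Prod>e\<leftarrow>es. [:- e, 1:])"
  shows "\<exists>V\<in>carrier_mat n n. mat_adjoint V * V = 1\<^sub>m n \<and>
    M = V * mat_diag n (\<lambda>i. es ! i) * mat_adjoint V"
  using assms
proof (induction es arbitrary: n M)
  case Nil
  then have "n = 0" using degree_monic_char_poly[of M n] by auto
  with Nil show ?case by (intro bexI[of _ "1\<^sub>m 0"]) (auto intro!: eq_matI)
next
  case (Cons e es)
  note M = Cons.prems(1) and herm = Cons.prems(2)
  have cp: "char_poly M = [:- e, 1:] * (\<Prod>e\<leftarrow>es. [:- e, 1:])" using Cons.prems(3) by simp
  have "monic (\<Prod>e\<leftarrow>es. [:- e, 1:])" by (rule monic_prod_list) auto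
  then have "degree (char_poly M) = Suc (degree (\<Prod>e\<leftarrow>es. [:- e, 1:]))"
    unfolding cp by (subst degree_mult_eq) auto
  with degree_monic_char_poly[OF M] obtain n1 where n: "n = Suc n1" by (cases n) auto
  have "eigenvalue M e" unfolding eigenvalue_root_char_poly[OF M] cp by simp
  then obtain v where v: "v \<in> carrier_vec n" "v \<noteq> 0\<^sub>v n" "M *\<^sub>v v = e \<cdot>\<^sub>v v"
    using M by (auto simp: eigenvalue_def eigenvector_def)
  obtain W c where W: "W \<in> carrier_mat n n" "mat_adjoint W * W = 1\<^sub>m n" "W * mat_adjoint W = 1\<^sub>m n"
    and col: "col W 0 = c \<cdot>\<^sub>v v" using unitary_with_first_col[OF v(1,2)] by metis
  define X where "X = mat_adjoint W"
  have X: "X \<in> carrier_mat n n" and XW: "X * W = 1\<^sub>m n" and WX: "W * X = 1\<^sub>m n"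
    using W by (auto simp: X_def)
  define N where "N = X * M * W"
  have N: "N \<in> carrier_mat n n" using M W X by (simp add: N_def)
  have hN: "mat_adjoint N = N"
    using M W(1) X herm
    by (simp add: N_def X_def mat_adjoint_mult[of _ n n _ n] assoc_mult_mat[of _ n n _ n _ n])
  have M_eq: "M = W * N * X"
  proof -
    have "W * N * X = W * X * M * (W * X)"
      using M W(1) X by (simp add: N_def assoc_mult_mat[of _ n n _ n _ n])
    then show ?thesis using M by (simp add: WX)
  qed
  have "M *\<^sub>v col W 0 = e \<cdot>\<^sub>v col W 0"
    using v M by (simp add: col mult_mat_vec smult_smult_assoc mult.commute)
  then have "col N 0 = e \<cdot>\<^sub>v col (X * W) 0"
    using M W(1) X n carrier_vecI[of "col W 0" n] by (simp add: N_def assoc_mult_mat[of _ n n _ n _ n] mult_carrier_mat[of _ n n]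
        col_mult2[of _ n n _ n] mult_mat_vec[of X n n] del: col_mult col_mult2)
  then have colN: "col N 0 = e \<cdot>\<^sub>v unit_vec n 0" using n by (simp add: XW)
  have col0: "N $$ (i, 0) = (if i = 0 then e else 0)" if "i < n" for i
  proof -
    have "N $$ (i, 0) = col N 0 $ i" using N that n by simp
    then show ?thesis unfolding colN using that n by simp
  qed
  \<comment> \<open>The first column of N is e times a unit vector because of the eigenvector;
    hermitian symmetry then clears the first row.\<close>
  have row0: "N $$ (0, j) = 0" if "0 < j" "j < n" for j
  proof -
    have "mat_adjoint N $$ (0, j) = conjugate (N $$ (j, 0))" using N that by auto
    then show ?thesis using col0[of j] that by (simp add: hN)
  qed
  define E where "E = mat 1 1 (\<lambda>_. e)"
  define M3 where "M3 = mat n1 n1 (\<lambda>(i, j). N $$ (Suc i, Suc j))"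
  have E: "E \<in> carrier_mat 1 1" and M3: "M3 \<in> carrier_mat n1 n1" by (auto simp: E_def M3_def)
  have N_block: "N = four_block_mat E (0\<^sub>m 1 n1) (0\<^sub>m n1 1) M3"
    using N n col0 row0 by (intro eq_matI) (auto simp: E_def M3_def)
  have "char_poly M = char_poly N"
    using M N W X XW WX M_eq
    by (intro char_poly_similar similar_matI[of _ _ W X n]) auto
  also have "\<dots> = char_poly E * char_poly M3"
    unfolding N_block by (rule char_poly_four_block_zeros_col[OF E _ M3]) auto
  also have "char_poly E = [:- e, 1:]"
    by (simp add: E_def char_poly_defs det_def sign_def)
  finally have "char_poly M3 = (\<Prod>e\<leftarrow>es. [:- e, 1:])"
    using cp by (metis mult_cancel_left pCons_eq_0_iff zero_neq_one)
  moreover have "mat_adjoint M3 = M3"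
  proof (rule eq_matI)
    fix i j assume ij: "i < dim_row M3" "j < dim_col M3"
    have "mat_adjoint N $$ (Suc i, Suc j) = conjugate (N $$ (Suc j, Suc i))"
      using N n M3 ij by auto
    then show "mat_adjoint M3 $$ (i, j) = M3 $$ (i, j)"
      using ij by (simp add: hN M3_def)
  qed (auto simp: M3_def)
  ultimately obtain V3 where V3: "V3 \<in> carrier_mat n1 n1" "mat_adjoint V3 * V3 = 1\<^sub>m n1"
    "M3 = V3 * mat_diag n1 (\<lambda>i. es ! i) * mat_adjoint V3"
    using Cons.IH[OF M3] by blast
  let ?b = "\<lambda>A D. four_block_mat A (0\<^sub>m 1 n1) (0\<^sub>m n1 1) (D :: 'a mat)"
  \<comment> \<open>P extends the diagonalising matrix of the smaller block by a 1 in the corner, so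
    \<open>W * P\<close> diagonalises M.\<close>
  define P where "P = ?b (1\<^sub>m 1) V3"
  have P: "P \<in> carrier_mat n n" using V3 n by (auto simp: P_def)
  have P': "mat_adjoint P = ?b (1\<^sub>m 1) (mat_adjoint V3)"
    unfolding P_def using V3 by (subst mat_adjoint_four_block_diag) auto
  have D: "mat_diag n (\<lambda>i. (e # es) ! i) = ?b E (mat_diag n1 (\<lambda>i. es ! i))"
    using n by (intro eq_matI) (auto simp: mat_diag_def E_def nth_Cons')
  have "mat_adjoint P * P = ?b (1\<^sub>m 1) (1\<^sub>m n1)"
    unfolding P' unfolding P_def using V3 by (subst mult_four_block_diag) auto
  also have "\<dots> = 1\<^sub>m n" using n by (intro eq_matI) auto
  finally have PP: "mat_adjoint P * P = 1\<^sub>m n" .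
  have PD: "P * mat_diag n (\<lambda>i. (e # es) ! i) = ?b E (V3 * mat_diag n1 (\<lambda>i. es ! i))"
    unfolding D P_def using V3(1) E by (subst mult_four_block_diag) auto
  have "P * mat_diag n (\<lambda>i. (e # es) ! i) * mat_adjoint P = N"
    unfolding PD P' N_block V3(3) using V3(1) E
    by (subst mult_four_block_diag[of _ 1 1 _ n1 n1 _ 1 _ n1]) auto
  then have "M = W * (P * mat_diag n (\<lambda>i. (e # es) ! i) * mat_adjoint P) * X"
    using M_eq by simp
  also have "\<dots> = (W * P) * mat_diag n (\<lambda>i. (e # es) ! i) * mat_adjoint (W * P)"
    using W(1) P X by (simp add: X_def mat_adjoint_mult[of _ n n _ n] assoc_mult_mat[of _ n n _ n _ n]
        mult_carrier_mat[of _ n n])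
  finally have "M = (W * P) * mat_diag n (\<lambda>i. (e # es) ! i) * mat_adjoint (W * P)" .
  moreover have "mat_adjoint (W * P) * (W * P) = 1\<^sub>m n"
  proof -
    have "mat_adjoint (W * P) * (W * P) = mat_adjoint P * (X * W) * P"
      using W(1) P X by (simp add: X_def mat_adjoint_mult[of _ n n _ n] assoc_mult_mat[of _ n n _ n _ n]
        mult_carrier_mat[of _ n n])
    then show ?thesis using P PP by (simp add: XW right_mult_one_mat[of _ n n])
  qed
  ultimately show ?case using W(1) P by (intro bexI[of _ "W * P"]) auto
qed

text \<open>The only property of the field beyond \<^class>\<open>rc_field\<close>; over the reals it follows from the complex case.\<close>

definition hermitian_splits :: "'a :: rc_field itself \<Rightarrow> bool" where
  "hermitian_splits _ \<longleftrightarrow> (\<forall>n. \<forall>M\<in>carrier_mat n n. mat_adjoint (M :: 'a mat) = M \<longrightarrow>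
     (\<exists>es. char_poly M = (\<Prod>e\<leftarrow>es. [:- e, 1:])))"

lemma hermitian_splits_complex: "hermitian_splits TYPE(complex)"
  unfolding hermitian_splits_def using char_poly_factorized by blast

text \<open>Over the complex numbers the matrix is unitarily diagonalisable. The diagonal matrix is
  again hermitian, so every root equals its own conjugate and is real; the factorisation descends
  because the embedding of real polynomials is injective.\<close>

lemma hermitian_splits_real: "hermitian_splits TYPE(real)"
  unfolding hermitian_splits_def
proof (intro allI ballI impI)
  fix n and M :: "real mat"
  assume M: "M \<in> carrier_mat n n" and sym: "mat_adjoint M = M"
  interpret of_real_poly_hom: map_poly_inj_idom_hom complex_of_real ..
  define N where "N = map_mat complex_of_real M"
  have N: "N \<in> carrier_mat n n" using M by (simp add: N_def)
  have hN: "mat_adjoint N = N"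
  proof (rule eq_matI)
    fix i j assume ij: "i < dim_row N" "j < dim_col N"
    then have "mat_adjoint M $$ (i, j) = M $$ (j, i)" using M by (auto simp: N_def)
    then show "mat_adjoint N $$ (i, j) = N $$ (i, j)"
      using ij M sym by (simp add: N_def)
  qed (use N in auto)
  obtain es where es: "char_poly N = (\<Prod>e\<leftarrow>es. [:- e, 1:])" and len: "length es = n"
    using char_poly_factorized[OF N] by blast
  obtain V where V: "V \<in> carrier_mat n n" "mat_adjoint V * V = 1\<^sub>m n"
    "N = V * mat_diag n (\<lambda>i. es ! i) * mat_adjoint V"
    using hermitian_diagonalization[OF N hN es] by blast
  have D: "mat_diag n (\<lambda>i. es ! i) = mat_adjoint V * N * V"
  proof -
    have "mat_adjoint V * N * V = (mat_adjoint V * V) * mat_diag n (\<lambda>i. es ! i) * (mat_adjoint V * V)"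
      unfolding V(3) using V(1) by (simp add: assoc_mult_mat[of _ n n _ n _ n] mult_carrier_mat[of _ n n])
    then show ?thesis by (simp add: V(2) left_mult_one_mat[of _ n n] right_mult_one_mat[of _ n n])
  qed
  have "mat_adjoint (mat_diag n (\<lambda>i. es ! i)) = mat_diag n (\<lambda>i. es ! i)"
    unfolding D using V(1) N hN
    by (simp add: mat_adjoint_mult[of _ n n _ n] assoc_mult_mat[of _ n n _ n _ n])
  then have "mat_adjoint (mat_diag n (\<lambda>i. es ! i)) $$ (i, i) = mat_diag n (\<lambda>i. es ! i) $$ (i, i)" for i
    by simp
  note herm_diag = this
  have "cnj (es ! i) = es ! i" if "i < n" for i
    using that herm_diag[of i] by (simp add: mat_diag_def)
  then have re: "es = map complex_of_real (map Re es)"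
    using len by (intro nth_equalityI) (auto simp: complex_eq_iff)
  have "map_poly complex_of_real (char_poly M) = char_poly N"
    unfolding N_def by (rule of_real_hom.char_poly_hom[OF M, symmetric])
  also have "\<dots> = map_poly complex_of_real (\<Prod>e\<leftarrow>map Re es. [:- e, 1:])"
  proof -
    have "map_poly complex_of_real (\<Prod>e\<leftarrow>xs. [:- e, 1:]) =
        (\<Prod>e\<leftarrow>map complex_of_real xs. [:- e, 1:])" for xs
      by (induction xs) (simp_all add: of_real_poly_hom.hom_mult o_def del: mult_pCons_left)
    then show ?thesis unfolding es using re by metis
  qed
  finally have "char_poly M = (\<Prod>e\<leftarrow>map Re es. [:- e, 1:])"
    by (simp only: of_real_poly_hom.eq_iff)
  then show "\<exists>es. char_poly M = (\<Prod>e\<leftarrow>es. [:- e, 1:])" by blast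
qed

lemma proots_prod_linear: "proots (\<Prod>e\<leftarrow>es. [:- e, 1:] :: 'a :: idom poly) = mset es"
proof (induction es)
  case (Cons e es)
  have "(\<Prod>e\<leftarrow>es. [:- e, 1:] :: 'a poly) \<noteq> 0" by (auto simp: prod_list_zero_iff)
  with Cons show ?case by (simp add: proots_mult del: mult_pCons_left)
qed simp

text \<open>\<open>singular_values\<close> sorts the values and forgets the eigenvalues behind them.
  Sorting the eigenvalues themselves by the same key gives a list aligned with it entry by
  entry.\<close>

lemma singular_values_char_poly:
  fixes A :: "'a :: rc_field mat"
  assumes "char_poly (mat_adjoint A * A) = (\<Prod>e\<leftarrow>es0. [:- e, 1:])"
  obtains es where "char_poly (mat_adjoint A * A) = (\<Prod>e\<leftarrow>es. [:- e, 1:])"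
    "singular_values A = map (\<lambda>e. sqrt (norm e)) es"
proof
  define f where "f = (\<lambda>e :: 'a. sqrt (norm e))"
  let ?es = "rev (sort_key f es0)"
  have "(\<Prod>e\<leftarrow>?es. [:- e, 1:]) = prod_mset (image_mset (\<lambda>e. [:- e, 1:]) (mset es0))"
    by (simp flip: prod_mset_prod_list)
  also have "\<dots> = (\<Prod>e\<leftarrow>es0. [:- e, 1:])" by (simp add: prod_mset_prod_list flip: mset_map)
  finally show "char_poly (mat_adjoint A * A) = (\<Prod>e\<leftarrow>?es. [:- e, 1:])" using assms by simp
  have "sorted_list_of_multiset (mset (map f es0)) = map f (sort_key f es0)"
    by (rule sorted_list_of_multiset_mset[THEN trans]) (auto intro!: properties_for_sort)
  then show "singular_values A = map (\<lambda>e. sqrt (norm e)) ?es"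
    unfolding singular_values_def assms proots_prod_linear by (simp add: f_def rev_map)
qed

section \<open>Compact singular value decomposition and pseudoinverse\<close>

text \<open>Side conditions on dimensions instead of carriers leave no free size parameters, so the
  simplifier can use this as a rewrite rule.\<close>

lemma assoc_mult_mat_dim:
  "dim_col A = dim_row B \<Longrightarrow> dim_col B = dim_row C \<Longrightarrow> A * B * C = A * (B * (C :: 'a :: semiring_0 mat))"
  by (rule assoc_mult_mat) auto

lemma mat_adjoint_mult_dim:
  "dim_col A = dim_row B \<Longrightarrow> mat_adjoint (A * B) = mat_adjoint B * mat_adjoint A"
  by (rule mat_adjoint_mult) auto

lemma mat_diag_dims [simp]: "dim_row (mat_diag n f) = n" "dim_col (mat_diag n f) = n"
  by (auto simp: mat_diag_def)

text \<open>With V diagonalising the Gram matrix of A, the columns of \<open>A * V\<close> are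
  orthogonal and their lengths are the singular values. B and Q keep the columns of
  \<open>A * V\<close> and V that belong to nonzero singular values; B thus absorbs the diagonal
  factor of the usual decomposition.\<close>

lemma compact_svd:
  fixes A :: "'a :: rc_field mat"
  assumes splits: "hermitian_splits TYPE('a)" and A: "A \<in> carrier_mat m n"
  obtains k B Q where "B \<in> carrier_mat m k" "Q \<in> carrier_mat n k"
    "A = B * mat_adjoint Q" "mat_adjoint Q * Q = 1\<^sub>m k"
    "mat_adjoint B * B = mat_diag k (\<lambda>i. of_real ((singular_values A ! i)\<^sup>2))"
    "\<And>i. i < k \<Longrightarrow> 0 < singular_values A ! i"
    "\<And>i. i < k \<Longrightarrow> singular_value A k \<le> singular_values A ! i"
proof -
  define sv where "sv = singular_values A"
  have H: "mat_adjoint A * A \<in> carrier_mat n n" using A by (auto intro: mult_carrier_mat)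
  have hH: "mat_adjoint (mat_adjoint A * A) = mat_adjoint A * A" by (simp add: mat_adjoint_mult_dim)
  obtain es0 where "char_poly (mat_adjoint A * A) = (\<Prod>e\<leftarrow>es0. [:- e, 1:])"
    using splits H hH unfolding hermitian_splits_def by blast
  then obtain es where es: "char_poly (mat_adjoint A * A) = (\<Prod>e\<leftarrow>es. [:- e, 1:])"
    and sv_es: "sv = map (\<lambda>e. sqrt (norm e)) es"
    unfolding sv_def by (rule singular_values_char_poly)
  have len: "length es = n"
    using degree_monic_char_poly[OF H] unfolding es by (simp add: degree_linear_factors[of uminus])
  then have len_sv: "length sv = n" by (simp add: sv_es)
  have "sorted (rev sv)" by (simp add: sv_def singular_values_def)
  then have mono: "sv ! j \<le> sv ! i" if "i \<le> j" "j < n" for i j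
    using sorted_rev_nth_mono[of sv i j] that len_sv by auto
  obtain V where V: "V \<in> carrier_mat n n" and VV: "mat_adjoint V * V = 1\<^sub>m n"
    and AA: "mat_adjoint A * A = V * mat_diag n (\<lambda>i. es ! i) * mat_adjoint V"
    using hermitian_diagonalization[OF H hH es] by blast
  note dims = carrier_matD[OF A] carrier_matD[OF V]
  have VV': "V * mat_adjoint V = 1\<^sub>m n" using left_inverse_imp_right_inverse[OF V _ VV] V by simp
  define W where "W = A * V"
  have W: "W \<in> carrier_mat m n" using A V by (auto simp: W_def)
  have "mat_adjoint W * W = mat_adjoint V * (mat_adjoint A * A) * V"
    by (simp add: W_def mat_adjoint_mult_dim assoc_mult_mat_dim dims)
  also have "\<dots> = (mat_adjoint V * V) * mat_diag n (\<lambda>i. es ! i) * (mat_adjoint V * V)"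
    unfolding AA by (simp add: assoc_mult_mat_dim dims)
  finally have WW: "mat_adjoint W * W = mat_diag n (\<lambda>i. es ! i)"
    by (simp add: VV left_mult_one_mat[of _ n n] right_mult_one_mat[of _ n n])
  \<comment> \<open>The eigenvalues are squared lengths, hence nonnegative, so \<open>norm\<close>
    in the definition of \<open>singular_values\<close> does not change them.\<close>
  have es_i: "es ! i = of_real ((vec_norm2 (col W i))\<^sup>2)" if "i < n" for i
    using col_norm_adjoint_mult[OF W that] that unfolding WW by (simp add: mat_diag_def)
  then have sv_i: "sv ! i = vec_norm2 (col W i)" if "i < n" for i
    using that len by (simp add: sv_es norm_power)
  \<comment> \<open>The values decrease, so the nonzero ones form a prefix, and k is its
    length.\<close>
  define k where "k = length (takeWhile (\<lambda>x. x \<noteq> 0) sv)"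
  have k: "k \<le> n" using length_takeWhile_le[of _ sv] by (simp add: k_def len_sv)
  have pos: "0 < sv ! i" if "i < k" for i
  proof -
    have "sv ! i \<noteq> 0" using that nth_mem[of i "takeWhile (\<lambda>x. x \<noteq> 0) sv"]
      by (auto simp: k_def takeWhile_nth dest: set_takeWhileD)
    then show ?thesis using sv_i[of i] that k by (simp add: less_le)
  qed
  have zero: "sv ! i = 0" if "k \<le> i" "i < n" for i
  proof -
    have "sv ! k = 0" using nth_length_takeWhile[of "\<lambda>x. x \<noteq> 0" sv] that by (simp add: k_def len_sv)
    then show ?thesis using mono[of k i] sv_i[of i] vec_norm2_nonneg[of "col W i"] that by linarith
  qed
  have W0: "W $$ (a, i) = 0" if "a < m" "k \<le> i" "i < n" for a i
  proof -
    have "col W i = 0\<^sub>v m"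
      using zero[OF that(2,3)] sv_i[OF that(3)] vec_norm2_eq_0_iff[of "col W i" m] W by auto
    then have "col W i $ a = 0" using that by simp
    then show ?thesis using W that by simp
  qed
  define B where "B = mat m k (\<lambda>(i, j). W $$ (i, j))"
  define Q where "Q = mat n k (\<lambda>(i, j). V $$ (i, j))"
  show thesis
  proof
    show B: "B \<in> carrier_mat m k" and Q: "Q \<in> carrier_mat n k" by (auto simp: B_def Q_def)
    have "A = W * mat_adjoint V"
      using A by (simp add: W_def assoc_mult_mat_dim dims VV' right_mult_one_mat[of _ m n])
    also have "\<dots> = B * mat_adjoint Q"
    proof (rule eq_matI)
      fix a b assume "a < dim_row (B * mat_adjoint Q)" "b < dim_col (B * mat_adjoint Q)"
      then have ab: "a < m" "b < n" by (auto simp: B_def Q_def)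
      have "(W * mat_adjoint V) $$ (a, b) = (\<Sum>l<n. W $$ (a, l) * conjugate (V $$ (b, l)))"
        using ab W V by (simp add: scalar_prod_def atLeast0LessThan)
      also have "\<dots> = (\<Sum>l<k. W $$ (a, l) * conjugate (V $$ (b, l)))"
        by (rule sum.mono_neutral_right) (use k W0 ab in auto)
      also have "\<dots> = (B * mat_adjoint Q) $$ (a, b)"
        using ab by (simp add: scalar_prod_def atLeast0LessThan B_def Q_def)
      finally show "(W * mat_adjoint V) $$ (a, b) = (B * mat_adjoint Q) $$ (a, b)" .
    qed (use W V B Q in auto)
    finally show "A = B * mat_adjoint Q" .
    have "(mat_adjoint Q * Q) $$ (i, j) = (mat_adjoint V * V) $$ (i, j)" if "i < k" "j < k" for i j
      using that k V by (simp add: scalar_prod_def Q_def)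
    then show "mat_adjoint Q * Q = 1\<^sub>m k"
      unfolding VV using k Q by (intro eq_matI) auto
    have "(mat_adjoint B * B) $$ (i, j) = (mat_adjoint W * W) $$ (i, j)" if "i < k" "j < k" for i j
      using that k W by (simp add: scalar_prod_def B_def)
    then show "mat_adjoint B * B = mat_diag k (\<lambda>i. of_real ((singular_values A ! i)\<^sup>2))"
      unfolding WW using k B es_i sv_i by (intro eq_matI) (auto simp: mat_diag_def simp flip: sv_def)
    show "0 < singular_values A ! i" if "i < k" for i using pos[OF that] by (simp add: sv_def)
    \<comment> \<open>\<open>singular_value\<close> counts from 1 and list positions from 0; the
      k-th value sits at position k - 1.\<close>
    show "singular_value A k \<le> singular_values A ! i" if "i < k" for i
      using mono[of i "k - 1"] that k by (simp add: singular_value_def sv_def)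
  qed
qed

text \<open>A matrix without columns always qualifies; this is the base case of the sampling
  induction.\<close>

definition trivial_kernel :: "'a :: semiring_0 mat \<Rightarrow> bool" where
  "trivial_kernel M \<longleftrightarrow>
    (\<forall>x\<in>carrier_vec (dim_col M). M *\<^sub>v x = 0\<^sub>v (dim_row M) \<longrightarrow> x = 0\<^sub>v (dim_col M))"

text \<open>A kernel vector of the Gram matrix is sent by F to a vector of length 0, so the Gram
  matrix is invertible. Its inverse inherits hermitian symmetry.\<close>

lemma gram_inverse:
  fixes F :: "'a :: rc_field mat"
  assumes F: "F \<in> carrier_mat m k" and ker: "trivial_kernel F"
  obtains X where "X \<in> carrier_mat k k" "X * (mat_adjoint F * F) = 1\<^sub>m k"
    "(mat_adjoint F * F) * X = 1\<^sub>m k" "mat_adjoint X = X"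
proof -
  let ?S = "mat_adjoint F * F"
  have S: "?S \<in> carrier_mat k k" using F by auto
  have "det ?S \<noteq> 0"
  proof
    assume "det ?S = 0"
    then obtain v where v: "v \<in> carrier_vec k" "v \<noteq> 0\<^sub>v k" "?S *\<^sub>v v = 0\<^sub>v k"
      using det_0_iff_vec_prod_zero_field[OF S] by blast
    have "(of_real ((vec_norm2 (F *\<^sub>v v))\<^sup>2) :: 'a) = 0"
      unfolding vec_norm2_mult_mat[OF F v(1)] v(3) using v(1)
      by (simp add: scalar_prod_def)
    then have "F *\<^sub>v v = 0\<^sub>v m" using vec_norm2_eq_0_iff[of "F *\<^sub>v v" m] F v(1) by simp
    then show False using ker F v by (auto simp: trivial_kernel_def)
  qed
  from det_non_zero_imp_unit[OF S this, of "()"]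
  obtain X where X: "X \<in> carrier_mat k k" "X * ?S = 1\<^sub>m k" "?S * X = 1\<^sub>m k"
    by (auto simp: Units_def ring_mat_simps)
  have "mat_adjoint X = mat_adjoint X * (?S * X)"
    unfolding X(3) using X(1) by (simp add: right_mult_one_mat[of _ k k])
  also have "\<dots> = mat_adjoint (?S * X) * X"
    using X(1) F by (simp add: mat_adjoint_mult_dim assoc_mult_mat_dim)
  also have "\<dots> = X" unfolding X(3) using X(1) by (simp add: left_mult_one_mat[of _ k k])
  finally show thesis using X that by blast
qed

text \<open>Justifies the definite description in \<open>pseudoinverse\<close>. The Penrose
  conditions give \<open>A * X = A * Y\<close> and \<open>X * A = Y * A\<close>, and then X and Y
  agree through \<open>X * A * X\<close>.\<close>

lemma is_pseudoinverse_unique: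
  fixes A :: "'a :: conjugatable_field mat"
  assumes X: "is_pseudoinverse A X" and Y: "is_pseudoinverse A Y"
  shows "X = Y"
proof -
  have dims: "dim_row X = dim_col A" "dim_col X = dim_row A" "dim_row Y = dim_col A" "dim_col Y = dim_row A"
    using X Y by (auto simp: is_pseudoinverse_def)
  note XD = X[unfolded is_pseudoinverse_def] and YD = Y[unfolded is_pseudoinverse_def]
  have "A * X = (A * Y * A) * X" using YD by simp
  also have "\<dots> = (A * Y) * (A * X)" using dims by (simp add: assoc_mult_mat_dim)
  also have "\<dots> = mat_adjoint (A * Y) * mat_adjoint (A * X)" using XD YD by simp
  also have "\<dots> = mat_adjoint ((A * X * A) * Y)"
    using dims by (simp add: assoc_mult_mat_dim mat_adjoint_mult_dim)
  also have "\<dots> = A * Y" using XD YD by simp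
  finally have AX: "A * X = A * Y" .
  have "X * A = X * (A * Y * A)" using YD by simp
  also have "\<dots> = (X * A) * (Y * A)" using dims by (simp add: assoc_mult_mat_dim)
  also have "\<dots> = mat_adjoint (X * A) * mat_adjoint (Y * A)" using XD YD by simp
  also have "\<dots> = mat_adjoint (Y * (A * X * A))"
    using dims by (simp add: assoc_mult_mat_dim mat_adjoint_mult_dim)
  also have "\<dots> = Y * A" using XD YD by simp
  finally have XA: "X * A = Y * A" .
  have "X = X * A * X" using XD by simp
  also have "\<dots> = Y * A * Y" using dims AX XA by (simp add: assoc_mult_mat_dim)
  also have "\<dots> = Y" using YD by simp
  finally show ?thesis .
qed

lemma pseudoinverse_eqI: "is_pseudoinverse A X \<Longrightarrow> pseudoinverse A = X"
  unfolding pseudoinverse_def using is_pseudoinverse_unique by blast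

lemma mult_cancel_middle:
  fixes A :: "'a :: semiring_1 mat"
  assumes "A * B = 1\<^sub>m k" "dim_col A = dim_row B" "dim_col B = k" "dim_row C = k"
  shows "A * (B * C) = C"
  using assms by (metis assoc_mult_mat_dim carrier_matI left_mult_one_mat)

text \<open>For injective factors the reverse-order law holds: \<open>X * mat_adjoint F\<close> is
  the pseudoinverse of F, and \<open>G * Y\<close> that of \<open>mat_adjoint G\<close>. The two
  products of U with the candidate are the orthogonal projections onto the column spaces of F and
  G.\<close>

lemma pseudoinverse_factored:
  fixes F G :: "'a :: rc_field mat"
  assumes F: "F \<in> carrier_mat m k" and G: "G \<in> carrier_mat n k"
    and X: "X \<in> carrier_mat k k" "X * (mat_adjoint F * F) = 1\<^sub>m k"
      "(mat_adjoint F * F) * X = 1\<^sub>m k" "mat_adjoint X = X"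
    and Y: "Y \<in> carrier_mat k k" "Y * (mat_adjoint G * G) = 1\<^sub>m k"
      "(mat_adjoint G * G) * Y = 1\<^sub>m k" "mat_adjoint Y = Y"
  shows "pseudoinverse (F * mat_adjoint G) = G * Y * X * mat_adjoint F"
proof (rule pseudoinverse_eqI)
  let ?U = "F * mat_adjoint G" and ?P = "G * Y * X * mat_adjoint F"
  note dims = carrier_matD[OF F] carrier_matD[OF G] carrier_matD[OF X(1)] carrier_matD[OF Y(1)]
  note assoc = assoc_mult_mat_dim mat_adjoint_mult_dim dims
  \<comment> \<open>The cancellation rules carry a trailing factor C, since products are normalised
    by associating to the right.\<close>
  have XF: "X * (mat_adjoint F * (F * C)) = C" if "dim_row C = k" for C
    using mult_cancel_middle[OF X(2), of C] that by (simp add: assoc)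
  have FX: "mat_adjoint F * (F * (X * C)) = C" if "dim_row C = k" for C
    using mult_cancel_middle[OF X(3), of C] that by (simp add: assoc)
  have YG: "Y * (mat_adjoint G * (G * C)) = C" if "dim_row C = k" for C
    using mult_cancel_middle[OF Y(2), of C] that by (simp add: assoc)
  have GY: "mat_adjoint G * (G * (Y * C)) = C" if "dim_row C = k" for C
    using mult_cancel_middle[OF Y(3), of C] that by (simp add: assoc)
  have UP: "?U * ?P = F * X * mat_adjoint F" by (simp add: assoc GY)
  have PU: "?P * ?U = G * Y * mat_adjoint G" by (simp add: assoc XF)
  show "is_pseudoinverse ?U ?P" unfolding is_pseudoinverse_def
  proof (intro conjI)
    show "?P \<in> carrier_mat (dim_col ?U) (dim_row ?U)" using F G by auto
    show "?U * ?P * ?U = ?U" unfolding UP by (simp add: assoc XF)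
    show "?P * ?U * ?P = ?P" unfolding PU by (simp add: assoc GY)
    show "mat_adjoint (?U * ?P) = ?U * ?P" unfolding UP by (simp add: assoc X(4))
    show "mat_adjoint (?P * ?U) = ?P * ?U" unfolding PU by (simp add: assoc Y(4))
  qed
qed

text \<open>Linear independence concerns the set of columns, so repeated columns must be excluded
  first: two equal ones would put a difference of unit vectors into the kernel.\<close>

lemma rank_trivial_kernel:
  fixes F :: "'a :: field mat"
  assumes F: "F \<in> carrier_mat d k" and ker: "trivial_kernel F"
  shows "vec_space.rank d F = k"
proof -
  interpret vec_space "TYPE('a)" d .
  have ker0: "x = 0\<^sub>v k" if "x \<in> carrier_vec k" "F *\<^sub>v x = 0\<^sub>v d" for x
    using ker F that by (auto simp: trivial_kernel_def)
  have dist: "distinct (cols F)"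
    unfolding distinct_conv_nth
  proof (intro allI impI notI)
    fix i j assume ij: "i < length (cols F)" "j < length (cols F)" "i \<noteq> j" "cols F ! i = cols F ! j"
    then have ijk: "i < k" "j < k" "col F i = col F j" using F by auto
    have "F *\<^sub>v (unit_vec k i - unit_vec k j) = F *\<^sub>v unit_vec k i - F *\<^sub>v unit_vec k j"
      using F by (intro mult_minus_distrib_mat_vec) auto
    also have "\<dots> = col F i - col F j" using F ijk(1,2) by (intro eq_vecI) auto
    also have "\<dots> = 0\<^sub>v d" unfolding ijk(3) using F by (intro eq_vecI) auto
    finally have "unit_vec k i - unit_vec k j = (0\<^sub>v k :: 'a vec)" by (intro ker0) auto
    then have "(unit_vec k i - unit_vec k j) $ i = (0\<^sub>v k :: 'a vec) $ i" by simp
    then show False using ijk ij(3) by simp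
  qed
  moreover have "lin_indpt (set (cols F))"
    using lin_depE[OF F _ dist] ker0 by blast
  ultimately show ?thesis using lin_indpt_full_rank[OF F] by blast
qed

text \<open>\<open>mat_adjoint G\<close> has the right inverse \<open>G * Y\<close>, hence is onto,
  and the product has the same column space as F.\<close>

lemma rank_factored:
  fixes F G :: "'a :: rc_field mat"
  assumes F: "F \<in> carrier_mat d k" "trivial_kernel F" and G: "G \<in> carrier_mat e k" "trivial_kernel G"
  shows "vec_space.rank d (F * mat_adjoint G) = k"
proof -
  interpret vec_space "TYPE('a)" d .
  let ?U = "F * mat_adjoint G"
  obtain Y where Y: "Y \<in> carrier_mat k k" "(mat_adjoint G * G) * Y = 1\<^sub>m k"
    using gram_inverse[OF G] by metis
  have U: "?U \<in> carrier_mat d e" using F G by auto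
  have "?U * (G * Y) = F * ((mat_adjoint G * G) * Y)"
    using F G Y by (simp add: assoc_mult_mat_dim)
  then have FU: "F = ?U * (G * Y)" using F Y by (simp add: right_mult_one_mat[of _ d k])
  have GY: "G * Y \<in> carrier_mat e k" using G(1) Y(1) by simp
  have "col_space ?U = col_space F"
  proof (intro equalityI subsetI)
    fix y assume "y \<in> col_space ?U"
    then obtain x where y: "y \<in> carrier_vec d" and x: "x \<in> carrier_vec e" "?U *\<^sub>v x = y"
      unfolding col_space_eq[OF U] carrier_matD[OF U] by blast
    have "F *\<^sub>v (mat_adjoint G *\<^sub>v x) = y"
      using assoc_mult_mat_vec[OF F(1) mat_adjoint_carrier[OF G(1)] x(1)] x(2) by simp
    moreover have "mat_adjoint G *\<^sub>v x \<in> carrier_vec k"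
      by (rule mult_mat_vec_carrier[OF mat_adjoint_carrier[OF G(1)] x(1)])
    ultimately show "y \<in> col_space F" unfolding col_space_eq[OF F(1)] using F(1) y by auto
  next
    fix y assume "y \<in> col_space F"
    then obtain x where y: "y \<in> carrier_vec d" and x: "x \<in> carrier_vec k" "F *\<^sub>v x = y"
      unfolding col_space_eq[OF F(1)] using F(1) by auto
    have "F *\<^sub>v x = ?U *\<^sub>v ((G * Y) *\<^sub>v x)"
      using arg_cong[OF FU, of "\<lambda>M. M *\<^sub>v x"] assoc_mult_mat_vec[OF U GY x(1)] by (rule trans)
    then have "?U *\<^sub>v ((G * Y) *\<^sub>v x) = y" using x(2) by simp
    moreover have "(G * Y) *\<^sub>v x \<in> carrier_vec e" by (rule mult_mat_vec_carrier[OF GY x(1)])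
    ultimately show "y \<in> col_space ?U"
      unfolding col_space_eq[OF U] carrier_matD[OF U] using y by blast
  qed
  then have "rank ?U = rank F" by (simp add: rank_def col_space_def)
  then show ?thesis using rank_trivial_kernel[OF F] by simp
qed

text \<open>With F and G the sampled rows of B and Q, the matrices U, C and R factor as
  \<open>F * mat_adjoint G\<close>, \<open>B * mat_adjoint G\<close> and
  \<open>F * mat_adjoint Q\<close>. Inserting the explicit pseudoinverse, each Gram matrix meets its
  inverse and \<open>B * mat_adjoint Q\<close> remains.\<close>

lemma cur_decomposition_factored:
  fixes B Q :: "'a :: rc_field mat"
  assumes B: "B \<in> carrier_mat m k" and Q: "Q \<in> carrier_mat n k" and A: "A = B * mat_adjoint Q"
    and I: "set I \<subseteq> {..<m}" "trivial_kernel (sub_rows B I)"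
    and J: "set J \<subseteq> {..<n}" "trivial_kernel (sub_rows Q J)"
  shows "vec_space.rank (length I) (sub_mat A I J) = k"
    and "A = sub_cols A J * pseudoinverse (sub_mat A I J) * sub_rows A I"
proof -
  let ?F = "sub_rows B I" and ?G = "sub_rows Q J"
  have F: "?F \<in> carrier_mat (length I) k" using B by (simp add: sub_rows_def)
  have G: "?G \<in> carrier_mat (length J) k" using Q by (simp add: sub_rows_def)
  have In: "I ! a < m" if "a < length I" for a using I(1) nth_mem[OF that] by auto
  have Jn: "J ! b < n" if "b < length J" for b using J(1) nth_mem[OF that] by auto
  have U: "sub_mat A I J = ?F * mat_adjoint ?G"
    using B Q In Jn by (intro eq_matI) (auto simp: A sub_mat_def sub_rows_def scalar_prod_def)
  have C: "sub_cols A J = B * mat_adjoint ?G"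
    using B Q Jn by (intro eq_matI) (auto simp: A sub_cols_def sub_rows_def scalar_prod_def)
  have R: "sub_rows A I = ?F * mat_adjoint Q"
    using B Q In by (intro eq_matI) (auto simp: A sub_rows_def scalar_prod_def)
  show "vec_space.rank (length I) (sub_mat A I J) = k"
    unfolding U by (rule rank_factored[OF F I(2) G J(2)])
  obtain X where X: "X \<in> carrier_mat k k" "X * (mat_adjoint ?F * ?F) = 1\<^sub>m k"
    "(mat_adjoint ?F * ?F) * X = 1\<^sub>m k" "mat_adjoint X = X" using gram_inverse[OF F I(2)] .
  obtain Y where Y: "Y \<in> carrier_mat k k" "Y * (mat_adjoint ?G * ?G) = 1\<^sub>m k"
    "(mat_adjoint ?G * ?G) * Y = 1\<^sub>m k" "mat_adjoint Y = Y" using gram_inverse[OF G J(2)] .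
  have "sub_cols A J * pseudoinverse (sub_mat A I J) * sub_rows A I =
      B * ((mat_adjoint ?G * ?G) * Y) * (X * (mat_adjoint ?F * ?F)) * mat_adjoint Q"
    unfolding U C R pseudoinverse_factored[OF F G X Y]
    using carrier_matD[OF F] carrier_matD[OF G] carrier_matD[OF B] carrier_matD[OF Q]
      carrier_matD[OF X(1)] carrier_matD[OF Y(1)]
    by (simp add: assoc_mult_mat_dim)
  also have "\<dots> = A" unfolding X(2) Y(3) A using B by (simp add: right_mult_one_mat[of _ m k])
  finally show "A = sub_cols A J * pseudoinverse (sub_mat A I J) * sub_rows A I" by simp
qed

section \<open>Uniform sampling of rows\<close>

text \<open>In this form only \<open>set I\<close> enters, so order and repetitions are irrelevant
  and drawing further rows preserves injectivity.\<close>

lemma trivial_kernel_sub_rows: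
  assumes "M \<in> carrier_mat m j" "set I \<subseteq> {..<m}"
  shows "trivial_kernel (sub_rows M I) \<longleftrightarrow>
    (\<forall>x\<in>carrier_vec j. (\<forall>i\<in>set I. row M i \<bullet> x = 0) \<longrightarrow> x = 0\<^sub>v j)"
proof -
  have row: "row (sub_rows M I) a = row M (I ! a)" if "a < length I" for a
    using assms subsetD[OF assms(2) nth_mem[OF that]] that
    by (intro eq_vecI) (auto simp: sub_rows_def)
  have "sub_rows M I *\<^sub>v x = 0\<^sub>v (length I) \<longleftrightarrow> (\<forall>i\<in>set I. row M i \<bullet> x = 0)" for x
    unfolding all_set_conv_all_nth by (auto simp: vec_eq_iff row) (auto simp: sub_rows_def simp flip: row)
  then show ?thesis using assms(1) by (auto simp: trivial_kernel_def sub_rows_def)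
qed

lemma sum_row_norms_eq_cols:
  fixes M :: "'a :: real_normed_vector mat"
  assumes "M \<in> carrier_mat m n"
  shows "(\<Sum>i<m. (vec_norm2 (row M i))\<^sup>2) = (\<Sum>j<n. (vec_norm2 (col M j))\<^sup>2)"
  using assms by (simp add: vec_norm2_sq) (rule sum.swap)

lemma frob_norm_rows:
  fixes M :: "'a :: real_normed_vector mat"
  assumes "M \<in> carrier_mat m n"
  shows "(frob_norm M)\<^sup>2 = (\<Sum>i<m. (vec_norm2 (row M i))\<^sup>2)"
  using assms
  by (simp add: frob_norm_def L2_set_def sum_nonneg vec_norm2_sq sum.cartesian_product case_prod_unfold)

text \<open>Each column is the image of a unit vector and so has squared length at least s; summing
  squared entries by columns or by rows gives the same total.\<close>

lemma sum_row_norms_ge: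
  fixes M :: "'a :: rc_field mat"
  assumes M: "M \<in> carrier_mat m j"
    and lower: "\<And>y. y \<in> carrier_vec j \<Longrightarrow> s * (vec_norm2 y)\<^sup>2 \<le> (vec_norm2 (M *\<^sub>v y))\<^sup>2"
  shows "real j * s \<le> (\<Sum>i<m. (vec_norm2 (row M i))\<^sup>2)"
proof -
  have "s \<le> (vec_norm2 (col M l))\<^sup>2" if "l < j" for l
  proof -
    have "M *\<^sub>v unit_vec j l = col M l" using M that by (intro eq_vecI) auto
    moreover have "(vec_norm2 (unit_vec j l :: 'a vec))\<^sup>2 = 1"
    proof -
      have "(norm (unit_vec j l $ i :: 'a))\<^sup>2 = (if i = l then 1 else 0)" if "i < j" for i
        using that \<open>l < j\<close> by simp
      then show ?thesis using that by (simp add: vec_norm2_sq)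
    qed
    ultimately show ?thesis using lower[of "unit_vec j l"] by simp
  qed
  then have "(\<Sum>l<j. s) \<le> (\<Sum>l<j. (vec_norm2 (col M l))\<^sup>2)" by (intro sum_mono) auto
  then show ?thesis unfolding sum_row_norms_eq_cols[OF M] by simp
qed

text \<open>
  Sampling a nonzero row \<open>u\<close> of \<open>M\<close> restricts the kernel of the sampled rows to the orthogonal
  complement of \<open>u\<close>; in an orthonormal basis of that complement \<open>M\<close> becomes a matrix with one
  column less that satisfies the same bounds.
\<close>

lemma row_deflation:
  fixes M :: "'a :: rc_field mat"
  assumes M: "M \<in> carrier_mat m (Suc j)" and i: "i < m" and nz: "row M i \<noteq> 0\<^sub>v (Suc j)"
    and lower: "\<And>y. y \<in> carrier_vec (Suc j) \<Longrightarrow> s * (vec_norm2 y)\<^sup>2 \<le> (vec_norm2 (M *\<^sub>v y))\<^sup>2"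
    and upper: "\<And>a. a < m \<Longrightarrow> (vec_norm2 (row M a))\<^sup>2 \<le> L"
  obtains N :: "'a mat" where "N \<in> carrier_mat m j"
    "\<And>y. y \<in> carrier_vec j \<Longrightarrow> s * (vec_norm2 y)\<^sup>2 \<le> (vec_norm2 (N *\<^sub>v y))\<^sup>2"
    "\<And>a. a < m \<Longrightarrow> (vec_norm2 (row N a))\<^sup>2 \<le> L"
    "\<And>I. set I \<subseteq> {..<m} \<Longrightarrow> trivial_kernel (sub_rows N I) \<Longrightarrow> trivial_kernel (sub_rows M (i # I))"
proof -
  \<comment> \<open>\<open>row M i \<bullet> x\<close> is bilinear, so its kernel is the orthogonal
    complement of the conjugated row.\<close>
  define u where "u = conjugate (row M i)"
  have u: "u \<in> carrier_vec (Suc j)" "u \<noteq> 0\<^sub>v (Suc j)"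
    using M nz carrier_vecI[of "row M i" "Suc j"] by (auto simp: u_def)
  obtain W c where W: "W \<in> carrier_mat (Suc j) (Suc j)" "mat_adjoint W * W = 1\<^sub>m (Suc j)"
    "W * mat_adjoint W = 1\<^sub>m (Suc j)" and colW: "col W 0 = c \<cdot>\<^sub>v u" and c: "c \<noteq> 0"
    using unitary_with_first_col[OF u] by metis
  note dims = carrier_matD[OF M] carrier_matD[OF W(1)]
  define K where "K = M * W"
  have K: "K \<in> carrier_mat m (Suc j)" using M W by (simp add: K_def)
  have KK: "K * mat_adjoint K = M * mat_adjoint M"
  proof -
    have "K * mat_adjoint K = M * (W * mat_adjoint W) * mat_adjoint M"
      by (simp add: K_def mat_adjoint_mult_dim assoc_mult_mat_dim dims)
    then show ?thesis using M by (simp add: W(3) right_mult_one_mat[of _ m "Suc j"])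
  qed
  have Ki: "K $$ (i, l) = col W l \<bullet>c u" if "l \<le> j" for l
    using that i M W(1) by (simp add: K_def u_def scalar_prod_def mult.commute)
  have "c * (u \<bullet>c u) \<noteq> 0"
    using c u conjugate_square_eq_0_vec[OF u(1)] by auto
  then have Ki0: "K $$ (i, 0) \<noteq> 0" using u(1) by (simp add: Ki colW)
  \<comment> \<open>All columns of W but the first are orthogonal to u, so in the new basis row i
    keeps only its entry 0.\<close>
  have Kil: "K $$ (i, l) = 0" if "0 < l" "l \<le> j" for l
  proof -
    have "0 = col W l \<bullet>c col W 0" using isometry_iff_cols[OF W(1)] W(2) that by auto
    also have "\<dots> = conjugate c * (col W l \<bullet>c u)"
      using u(1) W(1) by (simp add: colW scalar_prod_def sum_distrib_left conjugate_dist_mul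
          mult.left_commute distrib_left)
    finally show ?thesis using c that by (simp add: Ki)
  qed
  define N where "N = mat m j (\<lambda>(a, b). K $$ (a, Suc b))"
  have N: "N \<in> carrier_mat m j" by (simp add: N_def)
  have rowK: "row K a = vCons (K $$ (a, 0)) (row N a)" if "a < m" for a
    using that K by (intro eq_vecI) (auto simp: N_def vec_index_vCons)
  have K0: "K *\<^sub>v vCons 0 y = N *\<^sub>v y" if "y \<in> carrier_vec j" for y
    using that K N by (intro eq_vecI) (auto simp: rowK)
  have MW: "row M a \<bullet> (W *\<^sub>v z) = row K a \<bullet> z" if "a < m" "z \<in> carrier_vec (Suc j)" for a z
  proof -
    have "(K *\<^sub>v z) $ a = (M *\<^sub>v (W *\<^sub>v z)) $ a"
      unfolding K_def using M W(1) that(2) by (subst assoc_mult_mat_vec) auto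
    then show ?thesis using M K that(1) by simp
  qed
  show thesis
  proof
    show "N \<in> carrier_mat m j" by fact
    fix y :: "'a vec" assume y: "y \<in> carrier_vec j"
    \<comment> \<open>The lower bound for N at y is that for M at the image of \<open>?z\<close>
      under W, a vector of the same length as y.\<close>
    let ?z = "vCons 0 y"
    have z: "?z \<in> carrier_vec (Suc j)" using y by simp
    have "(vec_norm2 ?z)\<^sup>2 = (vec_norm2 y)\<^sup>2" by (simp add: vec_norm2_sq sum.lessThan_Suc_shift del: sum.lessThan_Suc)
    moreover have "vec_norm2 (W *\<^sub>v ?z) = vec_norm2 ?z" by (rule vec_norm2_isometry[OF W(1,2) z])
    moreover have "M *\<^sub>v (W *\<^sub>v ?z) = N *\<^sub>v y"
      using K0[OF y] M W(1) z by (simp add: K_def assoc_mult_mat_vec[of _ m "Suc j" _ "Suc j"])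
    ultimately show "s * (vec_norm2 y)\<^sup>2 \<le> (vec_norm2 (N *\<^sub>v y))\<^sup>2"
      using lower[OF mult_mat_vec_carrier[OF W(1) z]] by simp
  next
    fix a assume a: "a < m"
    have "(vec_norm2 (row N a))\<^sup>2 \<le> (vec_norm2 (row K a))\<^sup>2"
      unfolding rowK[OF a] by (simp add: vec_norm2_sq sum.lessThan_Suc_shift del: sum.lessThan_Suc)
    also have "\<dots> = (vec_norm2 (row M a))\<^sup>2" using row_norm_cong[OF K M KK a] by simp
    finally show "(vec_norm2 (row N a))\<^sup>2 \<le> L" using upper[OF a] by (rule order_trans)
  next
    fix I assume I: "set I \<subseteq> {..<m}" and tk: "trivial_kernel (sub_rows N I)"
    have iI: "set (i # I) \<subseteq> {..<m}" using I i by simp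
    show "trivial_kernel (sub_rows M (i # I))"
      unfolding trivial_kernel_sub_rows[OF M iI]
    proof (intro ballI impI)
      fix x :: "'a vec" assume x: "x \<in> carrier_vec (Suc j)" and ann: "\<forall>a\<in>set (i # I). row M a \<bullet> x = 0"
      define z where "z = mat_adjoint W *\<^sub>v x"
      have z: "z \<in> carrier_vec (Suc j)" unfolding z_def using W(1) x by (intro mult_mat_vec_carrier) auto
      have xz: "x = W *\<^sub>v z"
        using W x by (simp add: z_def flip: assoc_mult_mat_vec[of _ "Suc j" "Suc j" _ "Suc j"])
      obtain z0 z' where zz: "z = vCons z0 z'" and z': "z' \<in> carrier_vec j"
        using z by (cases z) auto
      have Kz: "K $$ (a, 0) * z0 + row N a \<bullet> z' = 0" if "a \<in> set (i # I)" for a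
        using MW[OF _ z, of a] ann that iI zz by (auto simp: xz rowK)
      \<comment> \<open>The equation of row i now involves \<open>z0\<close> alone, with a nonzero
        coefficient; the other equations then become those for N.\<close>
      have "row N i = 0\<^sub>v j" using i Kil by (intro eq_vecI) (auto simp: N_def)
      then have "z0 = 0" using Kz[of i] Ki0 z' by simp
      then have "\<forall>a\<in>set I. row N a \<bullet> z' = 0" using Kz by simp
      then have "z' = 0\<^sub>v j" using tk z' unfolding trivial_kernel_sub_rows[OF N I] by blast
      then have "z = 0\<^sub>v (Suc j)" using zz \<open>z0 = 0\<close> by (simp add: zero_vec_Suc)
      then show "x = 0\<^sub>v (Suc j)" using W(1) by (simp add: xz) (intro eq_vecI; auto)
    qed
  qed
qed

text \<open>Conditioning on the first draw, which is the recursion that the induction on the sample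
  size follows.\<close>

lemma prob_replicate_Suc:
  assumes "m > 0"
  shows "measure_pmf.prob (replicate_pmf (Suc d) (pmf_of_set {..<m})) S =
    (\<Sum>i<m. measure_pmf.prob (replicate_pmf d (pmf_of_set {..<m})) {I. i # I \<in> S}) / real m"
proof -
  let ?p = "pmf_of_set {..<m}"
  have set_p: "set_pmf ?p = {..<m}" using assms by (intro set_pmf_of_set) auto
  have "replicate_pmf (Suc d) ?p = bind_pmf ?p (\<lambda>i. map_pmf (Cons i) (replicate_pmf d ?p))"
    by (simp add: map_pmf_def)
  then have "measure_pmf.prob (replicate_pmf (Suc d) ?p) S =
      measure_pmf.expectation (bind_pmf ?p (\<lambda>i. map_pmf (Cons i) (replicate_pmf d ?p))) (indicator S)"
    by simp
  also have "\<dots> = (\<Sum>i<m. measure_pmf.expectation (map_pmf (Cons i) (replicate_pmf d ?p)) (indicator S) /\<^sub>R real m)"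
    using assms by (subst pmf_expectation_bind_pmf_of_set)
      (auto simp: set_replicate_pmf set_p intro!: finite_subset[OF _ finite_lists_length_eq[of "{..<m}" d]])
  also have "\<dots> = (\<Sum>i<m. measure_pmf.prob (replicate_pmf d ?p) {I. i # I \<in> S}) / real m"
    by (simp add: vimage_def divide_inverse mult.commute sum_distrib_left del: integral_map_pmf)
  finally show ?thesis .
qed

text \<open>
  Coupon collector: while the sampled rows leave a \<open>j\<close>-dimensional kernel, the next row lowers \<open>j\<close>
  with probability at least \<open>j * s / (m * L)\<close>, because the rows carry squared mass at least
  \<open>j * s\<close> on that kernel and each of them at most \<open>L\<close>.
\<close>

lemma prob_trivial_kernel_ge:
  fixes M :: "'a :: rc_field mat"
  assumes m: "m > 0" and L: "L > 0"
    and M: "M \<in> carrier_mat m j"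
    and lower: "\<And>y. y \<in> carrier_vec j \<Longrightarrow> s * (vec_norm2 y)\<^sup>2 \<le> (vec_norm2 (M *\<^sub>v y))\<^sup>2"
    and upper: "\<And>i. i < m \<Longrightarrow> (vec_norm2 (row M i))\<^sup>2 \<le> L"
  shows "1 - real j * exp (- (real d * (s / (real m * L)))) \<le>
    measure_pmf.prob (replicate_pmf d (pmf_of_set {..<m})) {I. set I \<subseteq> {..<m} \<and> trivial_kernel (sub_rows M I)}"
  using M lower upper
\<comment> \<open>Deflation changes both the matrix and its number of columns, so both are
  generalised; s and L stay fixed.\<close>
proof (induction d arbitrary: j M)
  case 0
  show ?case
  proof (cases "j = 0")
    case True
    have "trivial_kernel (sub_rows M [])"
      using trivial_kernel_sub_rows[OF 0(1), of "[]"] True by (auto intro!: eq_vecI)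
    then show ?thesis using True by simp
  next
    case False
    \<comment> \<open>Before any draw the bound is 1 - j, which is void for positive j.\<close>
    then have "1 - real j * exp (- (real 0 * (s / (real m * L)))) \<le> 0" by simp
    then show ?thesis using measure_nonneg order_trans by blast
  qed
next
  case (Suc d j M)
  define q where "q = s / (real m * L)"
  define e where "e = exp (- (real d * q))"
  let ?p = "replicate_pmf d (pmf_of_set {..<m})"
  let ?S = "{I. set I \<subseteq> {..<m} \<and> trivial_kernel (sub_rows M I)}"
  let ?T = "{i. i < m \<and> row M i \<noteq> 0\<^sub>v j}"
  \<comment> \<open>A zero row leaves the problem unchanged, while a nonzero one leaves a problem
    with one column less.\<close>
  have step: "1 - (real j - (if row M i \<noteq> 0\<^sub>v j then 1 else 0)) * e \<le>
      measure_pmf.prob ?p {I. i # I \<in> ?S}" if i: "i < m" for i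
  proof (cases "row M i = 0\<^sub>v j")
    case True
    have "{I. set I \<subseteq> {..<m} \<and> trivial_kernel (sub_rows M I)} \<subseteq> {I. i # I \<in> ?S}"
      using i trivial_kernel_sub_rows[OF Suc.prems(1)] by auto
    then have "measure_pmf.prob ?p {I. set I \<subseteq> {..<m} \<and> trivial_kernel (sub_rows M I)} \<le>
        measure_pmf.prob ?p {I. i # I \<in> ?S}" by (intro measure_pmf.finite_measure_mono) auto
    then show ?thesis using Suc.IH[OF Suc.prems] True by (simp add: e_def q_def)
  next
    case False
    then obtain j' where j: "j = Suc j'"
      using Suc.prems(1) by (cases j) auto
    obtain N :: "'a mat" where N: "N \<in> carrier_mat m j'"
      "\<And>y. y \<in> carrier_vec j' \<Longrightarrow> s * (vec_norm2 y)\<^sup>2 \<le> (vec_norm2 (N *\<^sub>v y))\<^sup>2"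
      "\<And>a. a < m \<Longrightarrow> (vec_norm2 (row N a))\<^sup>2 \<le> L"
      "\<And>I. set I \<subseteq> {..<m} \<Longrightarrow> trivial_kernel (sub_rows N I) \<Longrightarrow> trivial_kernel (sub_rows M (i # I))"
      using row_deflation[OF Suc.prems(1)[unfolded j] i False[unfolded j] Suc.prems(2)[unfolded j] Suc.prems(3)]
      by metis
    have "{I. set I \<subseteq> {..<m} \<and> trivial_kernel (sub_rows N I)} \<subseteq> {I. i # I \<in> ?S}"
      using i N(4) by auto
    then have "measure_pmf.prob ?p {I. set I \<subseteq> {..<m} \<and> trivial_kernel (sub_rows N I)} \<le>
        measure_pmf.prob ?p {I. i # I \<in> ?S}" by (intro measure_pmf.finite_measure_mono) auto
    moreover have "1 - real j' * exp (- (real d * (s / (real m * L)))) \<le>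
        measure_pmf.prob ?p {I. set I \<subseteq> {..<m} \<and> trivial_kernel (sub_rows N I)}"
      by (rule Suc.IH) (fact N)+
    ultimately show ?thesis using False by (simp add: e_def q_def j)
  qed
  have "real j * s \<le> (\<Sum>i<m. (vec_norm2 (row M i))\<^sup>2)"
    using sum_row_norms_ge[OF Suc.prems(1,2)] .
  also have "\<dots> \<le> (\<Sum>i<m. if row M i \<noteq> 0\<^sub>v j then L else 0)"
    using Suc.prems(3) vec_norm2_eq_0_iff[of "0\<^sub>v j :: 'a vec" j] by (intro sum_mono) simp
  also have "\<dots> = L * real (card ?T)" by (simp add: sum.If_cases Int_def conj_commute)
  \<comment> \<open>At least a fraction j q of the rows is nonzero and thus makes progress.\<close>
  finally have T: "real j * q * real m \<le> real (card ?T)"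
    using m L by (simp add: q_def field_simps)
  have "1 - real j * exp (- (real (Suc d) * q)) = 1 - real j * exp (- q) * e"
    by (simp add: e_def algebra_simps flip: exp_add)
  \<comment> \<open>The factor j (1 - q) bounds the mean dimension left after one draw from above; 1
    - q is at most exp (-q).\<close>
  also have "\<dots> \<le> 1 - real j * (1 - q) * e"
    using exp_ge_add_one_self[of "- q"] by (intro diff_left_mono mult_right_mono mult_left_mono) (auto simp: e_def)
  also have "\<dots> = (real m - (real j * real m - real j * q * real m) * e) / real m"
    using m by (simp add: field_simps)
  also have "\<dots> \<le> (real m - (real j * real m - real (card ?T)) * e) / real m"
    using T by (intro divide_right_mono diff_left_mono mult_right_mono) (auto simp: e_def)
  also have "real m - (real j * real m - real (card ?T)) * e =
      (\<Sum>i<m. 1 - (real j - (if row M i \<noteq> 0\<^sub>v j then 1 else 0)) * e)"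
  proof -
    have "(\<Sum>i<m. if row M i \<noteq> 0\<^sub>v j then 1 else 0) = real (card ?T)"
      by (simp add: sum.If_cases Int_def conj_commute)
    then have "real j * real m - real (card ?T) = (\<Sum>i<m. real j - (if row M i \<noteq> 0\<^sub>v j then 1 else 0))"
      by (simp only: sum_subtractf) simp
    then show ?thesis by (simp only: sum_subtractf sum_distrib_right[symmetric]) simp
  qed
  also have "\<dots> / real m \<le> (\<Sum>i<m. measure_pmf.prob ?p {I. i # I \<in> ?S}) / real m"
    using step by (intro divide_right_mono sum_mono) auto
  also have "\<dots> = measure_pmf.prob (replicate_pmf (Suc d) (pmf_of_set {..<m})) ?S"
    using prob_replicate_Suc[OF m] by simp
  finally show ?case by (simp add: q_def)
qed

section \<open>Proof of the corollary\<close>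

lemma diag_gram_norm:
  fixes M :: "'a :: rc_field mat"
  assumes M: "M \<in> carrier_mat m k" and gram: "mat_adjoint M * M = mat_diag k (\<lambda>i. of_real (f i))"
    and y: "y \<in> carrier_vec k"
  shows "(vec_norm2 (M *\<^sub>v y))\<^sup>2 = (\<Sum>i<k. f i * (norm (y $ i))\<^sup>2)"
proof -
  define w where "w = mat_diag k (\<lambda>i. of_real (f i)) *\<^sub>v y"
  have w: "w \<in> carrier_vec k" unfolding w_def by (rule mult_mat_vec_carrier[OF mat_diag_dim y])
  have w_i: "w $ i = of_real (f i) * y $ i" if "i < k" for i
    using that y
    by (simp add: w_def mat_diag_def scalar_prod_def if_distrib[of "\<lambda>a. a * _"] cong: if_cong)
  have "(of_real ((vec_norm2 (M *\<^sub>v y))\<^sup>2) :: 'a) = y \<bullet>c w"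
    unfolding vec_norm2_mult_mat[OF M y] gram w_def ..
  also have "\<dots> = (\<Sum>i<k. y $ i * conjugate (of_real (f i) * y $ i))"
    using y w by (simp add: scalar_prod_def atLeast0LessThan w_i)
  also have "\<dots> = (\<Sum>i<k. of_real (f i) * (y $ i * conjugate (y $ i)))"
    by (simp add: conjugate_dist_mul mult.left_commute)
  also have "\<dots> = of_real (\<Sum>i<k. f i * (norm (y $ i))\<^sup>2)"
    by (simp add: mult_conjugate)
  finally show ?thesis by (simp only: of_real_eq_iff)
qed

text \<open>The definition of \<alpha> solved for a single row. Norms and the nonvanishing condition
  are abstract, so that rows with \<alpha> and columns with \<beta> are both covered.\<close>

lemma incoherence_bound:
  fixes f :: "nat \<Rightarrow> real"
  assumes \<alpha>: "\<alpha> = 1 / sqrt (real m) * Min {F / f i | i. i < m \<and> P i}" "0 < \<alpha>"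
    and f: "\<And>i. 0 \<le> f i" "\<And>i. \<not> P i \<Longrightarrow> f i = 0" and i: "i < m"
  shows "(f i)\<^sup>2 \<le> F\<^sup>2 / (real m * \<alpha>\<^sup>2)"
proof (cases "P i \<and> f i \<noteq> 0")
  case True
  have "Min {F / f i | i. i < m \<and> P i} \<le> F / f i" using True i by (intro Min_le) auto
  then have "\<alpha> * sqrt (real m) * f i \<le> F"
    using True i f(1)[of i] by (simp add: \<alpha>(1) field_simps)
  then have "(\<alpha> * sqrt (real m) * f i)\<^sup>2 \<le> F\<^sup>2"
    using \<alpha>(2) f(1)[of i] by (intro power_mono) auto
  then show ?thesis using \<alpha>(2) i by (simp add: power_mult_distrib field_simps)
qed (use f(2)[of i] in auto)

text \<open>Put t = \<alpha>^2 / \<delta> and x = r / (\<epsilon>^4 \<delta>). For t at most 3 the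
  claimed bound is void. Otherwise the exponent is at least 2 t ln x: one half pays for the factor
  k, the other for the claimed rate.\<close>

lemma tail_estimate:
  fixes k d :: nat and F \<sigma> S \<epsilon> \<delta> \<alpha> r p :: real
  assumes k: "0 < k" and k\<sigma>: "real k * \<sigma>\<^sup>2 \<le> F\<^sup>2" and \<sigma>: "\<epsilon> < \<sigma> / S"
    and \<epsilon>: "0 < \<epsilon>" "\<epsilon> < 1" and \<delta>: "0 < \<delta>" "\<delta> < 1" and r: "r = F\<^sup>2 / S\<^sup>2"
    and \<alpha>: "0 < \<alpha>" "\<alpha> \<le> 1"
    and d: "real d \<ge> 2 * (r / (\<epsilon> ^ 4 * \<delta>)) * ln (r / (\<epsilon> ^ 4 * \<delta>))"
    and p: "0 \<le> p" "1 - real k * exp (- (real d * (\<sigma>\<^sup>2 * \<alpha>\<^sup>2 / F\<^sup>2))) \<le> p"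
  shows "max 0 (1 - 2 * exp (- (ln 2 / 3 * \<alpha>\<^sup>2 / \<delta>))) \<le> p"
proof (cases "\<alpha>\<^sup>2 / \<delta> \<le> 3")
  case True
  \<comment> \<open>The rate ln 2 / 3 is chosen so that the bound vanishes exactly at t = 3.\<close>
  then have "exp (- ln 2) \<le> exp (- (ln 2 / 3 * \<alpha>\<^sup>2 / \<delta>))"
    using mult_left_mono[OF True, of "ln 2 / 3"] by simp
  then show ?thesis using p(1) by (simp add: exp_minus)
next
  case False
  define t where "t = \<alpha>\<^sup>2 / \<delta>"
  define x where "x = r / (\<epsilon> ^ 4 * \<delta>)"
  have t: "3 < t" using False by (simp add: t_def)
  \<comment> \<open>Division by zero yields 0, so a positive lower bound on the quotient excludes
    zero for both numbers.\<close>
  have S0: "S \<noteq> 0" and s0: "\<sigma> \<noteq> 0" using \<sigma> \<epsilon>(1) by auto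
  have "0 < real k * \<sigma>\<^sup>2" using k s0 by simp
  then have F: "0 < F\<^sup>2" using k\<sigma> by linarith
  have r0: "0 < r" using F S0 by (simp add: r)
  have "\<epsilon>\<^sup>2 \<le> (\<sigma> / S)\<^sup>2" using \<sigma> \<epsilon>(1) by (intro power_mono) auto
  then have "\<epsilon>\<^sup>2 * S\<^sup>2 \<le> \<sigma>\<^sup>2" using S0 by (simp add: power_divide field_simps)
  then have \<sigma>F: "\<epsilon>\<^sup>2 / r \<le> \<sigma>\<^sup>2 / F\<^sup>2" using F S0 by (simp add: r field_simps)
  have "real k * (\<epsilon>\<^sup>2 / r) \<le> real k * (\<sigma>\<^sup>2 / F\<^sup>2)" using \<sigma>F by (intro mult_left_mono) auto
  also have "\<dots> \<le> 1" using k\<sigma> F by simp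
  finally have kr: "real k \<le> r / \<epsilon>\<^sup>2" using r0 \<epsilon>(1) by (simp add: field_simps)
  have "\<alpha>\<^sup>2 \<le> 1" using \<alpha> by (simp add: power_le_one)
  \<comment> \<open>Since \<alpha> is at most 1, t > 3 makes \<delta> small. This gives x at least 3
    k, hence x at least 3 > e and ln x at least 1.\<close>
  then have \<delta>3: "3 * \<delta> \<le> 1" using t \<delta>(1) by (simp add: t_def field_simps)
  have "\<epsilon>\<^sup>2 \<le> 1" using \<epsilon> by (simp add: power_le_one)
  have "3 * real k \<le> x"
  proof -
    have "\<epsilon>\<^sup>2 * (3 * \<delta>) \<le> 1 * 1" using \<open>\<epsilon>\<^sup>2 \<le> 1\<close> \<delta>3 \<delta>(1) by (intro mult_mono) auto
    then have "r / \<epsilon>\<^sup>2 * (\<epsilon>\<^sup>2 * (3 * \<delta>)) \<le> r / \<epsilon>\<^sup>2 * 1"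
      using r0 by (intro mult_left_mono) auto
    then have "3 * (r / \<epsilon>\<^sup>2) * (\<epsilon>\<^sup>2 * \<delta>) \<le> r / \<epsilon>\<^sup>2"
      by (simp only: mult_1_right mult.assoc mult.commute mult.left_commute)
    moreover have "x * (\<epsilon>\<^sup>2 * \<delta>) = r / \<epsilon>\<^sup>2"
      using \<epsilon>(1) \<delta>(1) by (simp add: x_def field_simps flip: power_add)
    ultimately have "3 * (r / \<epsilon>\<^sup>2) * (\<epsilon>\<^sup>2 * \<delta>) \<le> x * (\<epsilon>\<^sup>2 * \<delta>)" by simp
    then have "3 * (r / \<epsilon>\<^sup>2) \<le> x"
      by (rule mult_right_le_imp_le) (use \<epsilon>(1) \<delta>(1) in simp)
    then show ?thesis using kr by linarith
  qed
  then have x3: "3 \<le> x" and kx: "real k \<le> x" using k by auto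
  have lnx: "1 \<le> ln x" using x3 exp_le by (subst ln_ge_iff) auto
  have lnk: "ln (real k) \<le> ln x" using kx k by simp
  have "t * ln x \<le> (\<alpha>\<^sup>2 * (\<epsilon>\<^sup>2 / r)) * (x * ln x)"
  proof -
    have "(\<alpha>\<^sup>2 * (\<epsilon>\<^sup>2 / r)) * x = t / \<epsilon>\<^sup>2"
      using r0 \<epsilon>(1) \<delta>(1) by (simp add: x_def t_def field_simps flip: power_add)
    moreover have "t \<le> t / \<epsilon>\<^sup>2" using t \<epsilon>(1) \<open>\<epsilon>\<^sup>2 \<le> 1\<close> by (simp add: field_simps mult_left_le)
    ultimately have "t \<le> (\<alpha>\<^sup>2 * (\<epsilon>\<^sup>2 / r)) * x" by simp
    then have "t * ln x \<le> (\<alpha>\<^sup>2 * (\<epsilon>\<^sup>2 / r)) * x * ln x" using lnx by (intro mult_right_mono) auto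
    then show ?thesis by (simp only: mult.assoc)
  qed
  also have "\<dots> \<le> (\<alpha>\<^sup>2 * (\<sigma>\<^sup>2 / F\<^sup>2)) * (real d / 2)"
  proof (rule mult_mono)
    show "\<alpha>\<^sup>2 * (\<epsilon>\<^sup>2 / r) \<le> \<alpha>\<^sup>2 * (\<sigma>\<^sup>2 / F\<^sup>2)" using \<sigma>F by (intro mult_left_mono) auto
    have "2 * x * ln x \<le> real d" using d unfolding x_def[symmetric] .
    then show "x * ln x \<le> real d / 2" by simp
    show "0 \<le> x * ln x" using x3 lnx by simp
  qed simp
  also have "\<dots> = real d * (\<sigma>\<^sup>2 * \<alpha>\<^sup>2 / F\<^sup>2) / 2" by simp
  finally have "2 * (t * ln x) \<le> real d * (\<sigma>\<^sup>2 * \<alpha>\<^sup>2 / F\<^sup>2)"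
    by (simp only: le_divide_eq_numeral1 mult.commute)
  moreover have "ln (real k) \<le> t * ln x" using lnk lnx t mult_right_mono[of 1 t "ln x"] by linarith
  moreover have "ln 2 / 3 * t \<le> t * ln x"
  proof -
    have "ln 2 / 3 \<le> (1::real)" using ln_2_less_1 by linarith
    then have "ln 2 / 3 * t \<le> 1 * t" using t by (intro mult_right_mono) auto
    moreover have "t * 1 \<le> t * ln x" using lnx t by (intro mult_left_mono) auto
    ultimately show ?thesis by linarith
  qed
  ultimately have "- (real d * (\<sigma>\<^sup>2 * \<alpha>\<^sup>2 / F\<^sup>2)) \<le> - ln (real k) - ln 2 / 3 * t" by linarith
  then have "exp (- (real d * (\<sigma>\<^sup>2 * \<alpha>\<^sup>2 / F\<^sup>2))) \<le> exp (- ln (real k) - ln 2 / 3 * t)" by simp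
  also have "\<dots> = exp (- (ln 2 / 3 * t)) / real k"
  proof -
    have "exp (- ln (real k) - u) = exp (- u) / real k" for u
      using k by (simp add: exp_diff exp_minus divide_inverse mult.commute)
    then show ?thesis .
  qed
  finally have "real k * exp (- (real d * (\<sigma>\<^sup>2 * \<alpha>\<^sup>2 / F\<^sup>2))) \<le> exp (- (ln 2 / 3 * t))"
    using k by (simp add: field_simps)
  moreover have "0 < exp (- (ln 2 / 3 * t))" by simp
  ultimately have "1 - 2 * exp (- (ln 2 / 3 * t)) \<le> p" using p(2) by linarith
  then show ?thesis using p(1) by (simp add: t_def)
qed

text \<open>Combines the coupon collector bound, for the largest row mass L that \<alpha> permits,
  with the tail estimate. M need only share its row norms f with the rows or columns of the original
  matrix.\<close>

lemma uniform_sampling_full_rank: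
  fixes M :: "'a :: rc_field mat"
  assumes M: "M \<in> carrier_mat m k" and k: "0 < k"
    and lower: "\<And>y. y \<in> carrier_vec k \<Longrightarrow> \<sigma>\<^sup>2 * (vec_norm2 y)\<^sup>2 \<le> (vec_norm2 (M *\<^sub>v y))\<^sup>2"
    and rows: "\<And>i. i < m \<Longrightarrow> vec_norm2 (row M i) = f i" "\<And>i. 0 \<le> f i" "\<And>i. \<not> P i \<Longrightarrow> f i = 0"
    and F: "F\<^sup>2 = (\<Sum>i<m. (f i)\<^sup>2)"
    and \<alpha>: "\<alpha> = 1 / sqrt (real m) * Min {F / f i | i. i < m \<and> P i}" "0 < \<alpha>"
    and \<sigma>: "\<epsilon> < \<sigma> / S" and \<epsilon>: "0 < \<epsilon>" "\<epsilon> < 1" and \<delta>: "0 < \<delta>" "\<delta> < 1" and r: "r = F\<^sup>2 / S\<^sup>2"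
    and d: "real d \<ge> 2 * (r / (\<epsilon> ^ 4 * \<delta>)) * ln (r / (\<epsilon> ^ 4 * \<delta>))"
  shows "max 0 (1 - 2 * exp (- (ln 2 / 3 * \<alpha>\<^sup>2 / \<delta>))) \<le>
    measure_pmf.prob (replicate_pmf d (pmf_of_set {..<m})) {I. set I \<subseteq> {..<m} \<and> trivial_kernel (sub_rows M I)}"
proof -
  define L where "L = F\<^sup>2 / (real m * \<alpha>\<^sup>2)"
  have upper: "(vec_norm2 (row M i))\<^sup>2 \<le> L" if "i < m" for i
    unfolding rows(1)[OF that] L_def by (rule incoherence_bound[OF \<alpha> rows(2,3) that])
  have F_rows: "F\<^sup>2 = (\<Sum>i<m. (vec_norm2 (row M i))\<^sup>2)" using F rows(1) by simp
  have kF: "real k * \<sigma>\<^sup>2 \<le> F\<^sup>2"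
    unfolding F_rows by (rule sum_row_norms_ge[OF M lower])
  have "\<sigma> \<noteq> 0" using \<sigma> \<epsilon> by auto
  then have "0 < real k * \<sigma>\<^sup>2" using k by simp
  then have F0: "0 < F\<^sup>2" using kF by linarith
  then have m: "m > 0" unfolding F_rows by (cases m) auto
  have L: "L > 0" using F0 m \<alpha>(2) by (simp add: L_def)
  \<comment> \<open>All m rows have squared norm at most L, so the total is at most F^2 /
    \<alpha>^2; this forces \<alpha> to be at most 1.\<close>
  have "F\<^sup>2 \<le> (\<Sum>i<m. L)" unfolding F_rows using upper by (intro sum_mono) auto
  then have "\<alpha>\<^sup>2 \<le> 1" using F0 m \<alpha>(2) by (simp add: L_def field_simps)
  then have \<alpha>1: "\<alpha> \<le> 1" using \<alpha>(2) by (simp add: power_le_one_iff abs_square_le_1)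
  have "\<sigma>\<^sup>2 / (real m * L) = \<sigma>\<^sup>2 * \<alpha>\<^sup>2 / F\<^sup>2" using m \<alpha>(2) F0 by (simp add: L_def)
  then show ?thesis
    using prob_trivial_kernel_ge[OF m L M lower upper, of d]
    by (intro tail_estimate[OF k kF \<sigma> \<epsilon> \<delta> r \<alpha>(2) \<alpha>1 d]) (auto simp: measure_nonneg)
qed

lemma cur_sampling:
  fixes A :: "'a :: rc_field mat"
  assumes splits: "hermitian_splits TYPE('a)" and A: "A \<in> carrier_mat m n" "A \<noteq> 0\<^sub>m m n"
    and r: "r = (frob_norm A)\<^sup>2 / (spectral_norm A)\<^sup>2" and rank: "k = vec_space.rank m A"
    and \<alpha>: "\<alpha> = 1 / sqrt (real m) *
      Min {frob_norm A / vec_norm2 (row A i) | i. i < m \<and> row A i \<noteq> 0\<^sub>v n}"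
    and \<beta>: "\<beta> = 1 / sqrt (real n) *
      Min {frob_norm A / vec_norm2 (col A j) | j. j < n \<and> col A j \<noteq> 0\<^sub>v m}"
    and \<epsilon>: "0 < \<epsilon>" "\<epsilon> < 1" and \<delta>: "0 < \<delta>" "\<delta> < 1"
    and \<alpha>\<beta>: "\<epsilon>\<^sup>2 * sqrt \<delta> / 2 < min \<alpha> \<beta>"
    and \<sigma>: "\<epsilon> < singular_value A k / spectral_norm A"
    and d\<^sub>1: "real d\<^sub>1 \<ge> 2 * (r / (\<epsilon> ^ 4 * \<delta>)) * ln (r / (\<epsilon> ^ 4 * \<delta>))"
    and d\<^sub>2: "real d\<^sub>2 \<ge> 2 * (r / (\<epsilon> ^ 4 * \<delta>)) * ln (r / (\<epsilon> ^ 4 * \<delta>))"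
  shows "measure_pmf.prob (sample_indices m n d\<^sub>1 d\<^sub>2)
      {(I, J). let C = sub_cols A J; R = sub_rows A I; U = sub_mat A I J
               in vec_space.rank d\<^sub>1 U = k \<and> A = C * pseudoinverse U * R}
    \<ge> max 0 (1 - 2 * exp (- (ln 2 / 3 * \<alpha>\<^sup>2 / \<delta>))) * max 0 (1 - 2 * exp (- (ln 2 / 3 * \<beta>\<^sup>2 / \<delta>)))"
proof -
  obtain k' and B Q :: "'a mat" where B: "B \<in> carrier_mat m k'" and Q: "Q \<in> carrier_mat n k'"
    and AB: "A = B * mat_adjoint Q" and QQ: "mat_adjoint Q * Q = 1\<^sub>m k'"
    and BB: "mat_adjoint B * B = mat_diag k' (\<lambda>i. of_real ((singular_values A ! i)\<^sup>2))"
    and pos: "\<And>i. i < k' \<Longrightarrow> 0 < singular_values A ! i"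
    and least: "\<And>i. i < k' \<Longrightarrow> singular_value A k' \<le> singular_values A ! i"
    by (rule compact_svd[OF splits A(1)]) (rule that)
  define sv where "sv = (\<lambda>i. singular_values A ! i)"
  note dims = carrier_matD[OF B] carrier_matD[OF Q]
  \<comment> \<open>For the column sample, \<beta> controls the column norms of A. Scaling Q by the
    singular values gives G these as its row norms, and G has the same Gram matrix as B, so both
    samples fall under one lemma.\<close>
  define G where "G = Q * mat_diag k' (\<lambda>i. of_real (sv i))"
  have G: "G \<in> carrier_mat n k'" using Q by (auto simp: G_def intro: mult_carrier_mat)
  have diag_adj: "mat_adjoint (mat_diag k' (\<lambda>i. of_real (sv i) :: 'a)) = mat_diag k' (\<lambda>i. of_real (sv i))"
    by (rule eq_matI) (auto simp: mat_diag_def)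
  have sq: "(\<lambda>i. of_real ((singular_values A ! i)\<^sup>2) :: 'a) = (\<lambda>i. of_real (sv i) * of_real (sv i))"
    by (simp add: sv_def power2_eq_square)
  have GG: "mat_adjoint G * G = mat_diag k' (\<lambda>i. of_real ((singular_values A ! i)\<^sup>2))"
  proof -
    have "mat_adjoint G * G = mat_diag k' (\<lambda>i. of_real (sv i)) * (mat_adjoint Q * Q) * mat_diag k' (\<lambda>i. of_real (sv i))"
      by (simp add: G_def mat_adjoint_mult_dim assoc_mult_mat_dim dims diag_adj del: mat_diag_diag)
    then show ?thesis unfolding sq by (simp add: QQ right_mult_one_mat[of _ k' k'])
  qed
  have GG': "G * mat_adjoint G = mat_adjoint A * mat_adjoint (mat_adjoint A)"
  proof -
    have "G * mat_adjoint G = Q * (mat_diag k' (\<lambda>i. of_real (sv i)) * mat_diag k' (\<lambda>i. of_real (sv i))) * mat_adjoint Q"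
      by (simp add: G_def mat_adjoint_mult_dim assoc_mult_mat_dim dims diag_adj del: mat_diag_diag)
    also have "\<dots> = Q * (mat_adjoint B * B) * mat_adjoint Q"
      unfolding BB sq by simp
    finally show ?thesis by (simp add: AB mat_adjoint_mult_dim assoc_mult_mat_dim dims)
  qed
  have BB': "B * mat_adjoint B = A * mat_adjoint A"
  proof -
    have "A * mat_adjoint A = B * (mat_adjoint Q * Q) * mat_adjoint B"
      by (simp add: AB mat_adjoint_mult_dim assoc_mult_mat_dim dims)
    then show ?thesis using B by (simp add: QQ right_mult_one_mat[of _ m k'])
  qed
  define \<sigma>k where "\<sigma>k = singular_value A k'"
  have k'0: "0 < k'"
  proof (rule ccontr)
    assume "\<not> 0 < k'"
    then have "A = 0\<^sub>m m n" unfolding AB using B Q by (intro eq_matI) (auto simp: scalar_prod_def)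
    then show False using A(2) by simp
  qed
  have \<sigma>k_pos: "0 < \<sigma>k" using pos[of "k' - 1"] k'0 by (simp add: \<sigma>k_def singular_value_def)
  have lower: "\<sigma>k\<^sup>2 * (vec_norm2 y)\<^sup>2 \<le> (vec_norm2 (M *\<^sub>v y))\<^sup>2"
    if "M \<in> carrier_mat l k'" "mat_adjoint M * M = mat_diag k' (\<lambda>i. of_real ((singular_values A ! i)\<^sup>2))"
      "y \<in> carrier_vec k'" for M :: "'a mat" and l y
    unfolding diag_gram_norm[OF that] using that(3) \<sigma>k_pos least
    by (auto simp: vec_norm2_sq sum_distrib_left \<sigma>k_def intro!: sum_mono mult_right_mono power_mono)
  have injective: "x = 0\<^sub>v k'" if "M \<in> carrier_mat l k'"
    "mat_adjoint M * M = mat_diag k' (\<lambda>i. of_real ((singular_values A ! i)\<^sup>2))"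
    "x \<in> carrier_vec k'" "M *\<^sub>v x = 0\<^sub>v l" for M :: "'a mat" and l x
  proof -
    have "vec_norm2 (M *\<^sub>v x) = 0" using that(4) vec_norm2_eq_0_iff[of "0\<^sub>v l :: 'a vec" l] by simp
    then have "\<sigma>k\<^sup>2 * (vec_norm2 x)\<^sup>2 \<le> 0" using lower[OF that(1-3)] by simp
    then have "vec_norm2 x = 0" using \<sigma>k_pos by (simp add: mult_le_0_iff)
    then show ?thesis using vec_norm2_eq_0_iff[OF that(3)] by simp
  qed
  \<comment> \<open>Identifies the number of positive singular values with the rank, so that the
    hypothesis on \<epsilon> concerns the smallest positive one.\<close>
  have kk: "k = k'"
  proof -
    have "trivial_kernel B" using injective[OF B BB] B by (auto simp: trivial_kernel_def)
    moreover have "trivial_kernel Q" unfolding trivial_kernel_def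
    proof (intro ballI impI)
      fix x assume x: "x \<in> carrier_vec (dim_col Q)" "Q *\<^sub>v x = 0\<^sub>v (dim_row Q)"
      then have "vec_norm2 x = 0"
        using vec_norm2_isometry[OF Q QQ, of x] vec_norm2_eq_0_iff[of "Q *\<^sub>v x" n] Q by simp
      then show "x = 0\<^sub>v (dim_col Q)" using vec_norm2_eq_0_iff[OF x(1)] by simp
    qed
    ultimately show ?thesis unfolding rank AB by (rule rank_factored[OF B _ Q])
  qed
  have nz: "singular_values A ! i \<noteq> 0" if "i < k'" for i using pos[OF that] by simp
  have kernel_Q: "trivial_kernel (sub_rows Q J)"
    if J: "set J \<subseteq> {..<n}" and tk: "trivial_kernel (sub_rows G J)" for J
    unfolding trivial_kernel_sub_rows[OF Q J]
  proof (intro ballI impI)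
    fix x :: "'a vec" assume x: "x \<in> carrier_vec k'" "\<forall>j\<in>set J. row Q j \<bullet> x = 0"
    \<comment> \<open>Dividing coordinates by the singular values undoes the scaling, which carries
      injectivity from G back to Q.\<close>
    define y where "y = vec k' (\<lambda>i. x $ i / of_real (sv i))"
    have "row G j \<bullet> y = 0" if j: "j \<in> set J" for j
    proof -
      have "row G j \<bullet> y = row Q j \<bullet> x"
        using subsetD[OF J j] Q x(1) nz
        by (auto simp: G_def mat_diag_mult_right[of _ n k'] y_def scalar_prod_def sv_def intro!: sum.cong)
      then show ?thesis using x(2) j by simp
    qed
    moreover have y: "y \<in> carrier_vec k'" by (simp add: y_def)
    ultimately have "y = 0\<^sub>v k'" using tk unfolding trivial_kernel_sub_rows[OF G J] by blast
    then have "y $ i = 0" if "i < k'" for i using that by simp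
    then have "x $ i / of_real (sv i) = 0" if "i < k'" for i using that by (simp add: y_def)
    then show "x = 0\<^sub>v k'" using x(1) nz by (intro eq_vecI) (auto simp: sv_def)
  qed
  let ?pI = "replicate_pmf d\<^sub>1 (pmf_of_set {..<m})" and ?pJ = "replicate_pmf d\<^sub>2 (pmf_of_set {..<n})"
  let ?EI = "{I. set I \<subseteq> {..<m} \<and> trivial_kernel (sub_rows B I)}"
  let ?EJ = "{J. set J \<subseteq> {..<n} \<and> trivial_kernel (sub_rows G J)}"
  have "0 < \<epsilon>\<^sup>2 * sqrt \<delta> / 2" using \<epsilon> \<delta> by simp
  then have \<alpha>0: "0 < \<alpha>" and \<beta>0: "0 < \<beta>" using \<alpha>\<beta> by auto
  have \<sigma>': "\<epsilon> < \<sigma>k / spectral_norm A" using \<sigma> by (simp add: \<sigma>k_def kk)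
  have rows_B: "vec_norm2 (row B i) = vec_norm2 (row A i)" if "i < m" for i
    by (rule row_norm_cong[OF B A(1) BB' that])
  have rows_G: "vec_norm2 (row G j) = vec_norm2 (col A j)" if "j < n" for j
  proof -
    have "(of_real ((vec_norm2 (row G j))\<^sup>2) :: 'a) = of_real ((vec_norm2 (col A j))\<^sup>2)"
      using row_norm_mult_adjoint[OF G that] col_norm_adjoint_mult[OF A(1) that] by (simp only: GG' mat_adjoint_adjoint)
    then show ?thesis by (metis of_real_eq_iff vec_norm2_nonneg power2_eq_iff_nonneg)
  qed
  have zero_row: "vec_norm2 (row A i) = 0" if "\<not> row A i \<noteq> 0\<^sub>v n" for i
    using that vec_norm2_eq_0_iff[of "0\<^sub>v n :: 'a vec" n] by simp
  have zero_col: "vec_norm2 (col A j) = 0" if "\<not> col A j \<noteq> 0\<^sub>v m" for j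
    using that vec_norm2_eq_0_iff[of "0\<^sub>v m :: 'a vec" m] by simp
  have PI: "max 0 (1 - 2 * exp (- (ln 2 / 3 * \<alpha>\<^sup>2 / \<delta>))) \<le> measure_pmf.prob ?pI ?EI"
    by (rule uniform_sampling_full_rank[OF B k'0 lower[OF B BB] rows_B vec_norm2_nonneg zero_row
          frob_norm_rows[OF A(1)] \<alpha> \<alpha>0 \<sigma>' \<epsilon> \<delta> r d\<^sub>1])
  have PJ: "max 0 (1 - 2 * exp (- (ln 2 / 3 * \<beta>\<^sup>2 / \<delta>))) \<le> measure_pmf.prob ?pJ ?EJ"
    by (rule uniform_sampling_full_rank[OF G k'0 lower[OF G GG] rows_G vec_norm2_nonneg zero_col
          frob_norm_rows[OF A(1), unfolded sum_row_norms_eq_cols[OF A(1)]] \<beta> \<beta>0 \<sigma>' \<epsilon> \<delta> r d\<^sub>2])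
  have "max 0 (1 - 2 * exp (- (ln 2 / 3 * \<alpha>\<^sup>2 / \<delta>))) * max 0 (1 - 2 * exp (- (ln 2 / 3 * \<beta>\<^sup>2 / \<delta>)))
      \<le> measure_pmf.prob ?pI ?EI * measure_pmf.prob ?pJ ?EJ"
    using PI PJ by (intro mult_mono) (auto simp: measure_nonneg)
  also have "\<dots> = measure_pmf.prob (sample_indices m n d\<^sub>1 d\<^sub>2) (?EI \<times> ?EJ)"
    unfolding sample_indices_def by (rule measure_pmf_prob_product[symmetric]) auto
  also have "\<dots> \<le> measure_pmf.prob (sample_indices m n d\<^sub>1 d\<^sub>2)
      {(I, J). let C = sub_cols A J; R = sub_rows A I; U = sub_mat A I J
               in vec_space.rank d\<^sub>1 U = k \<and> A = C * pseudoinverse U * R}"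
  \<comment> \<open>The inclusion is needed only on the support, where the list I has length
    \<open>d\<^sub>1\<close>, the dimension in which the rank is taken.\<close>
  proof (intro measure_pmf.finite_measure_mono_AE)
    show "AE IJ in sample_indices m n d\<^sub>1 d\<^sub>2. IJ \<in> ?EI \<times> ?EJ \<longrightarrow>
      IJ \<in> {(I, J). let C = sub_cols A J; R = sub_rows A I; U = sub_mat A I J
               in vec_space.rank d\<^sub>1 U = k \<and> A = C * pseudoinverse U * R}"
      unfolding AE_measure_pmf_iff
    proof (intro ballI impI)
      fix IJ assume supp: "IJ \<in> set_pmf (sample_indices m n d\<^sub>1 d\<^sub>2)" and IJ: "IJ \<in> ?EI \<times> ?EJ"
      obtain I J where IJ_eq: "IJ = (I, J)" by (cases IJ)
      have len: "length I = d\<^sub>1"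
        using supp by (auto simp: IJ_eq sample_indices_def set_replicate_pmf)
      have I: "set I \<subseteq> {..<m}" "trivial_kernel (sub_rows B I)"
        and J: "set J \<subseteq> {..<n}" "trivial_kernel (sub_rows Q J)"
        using IJ kernel_Q by (auto simp: IJ_eq)
      show "IJ \<in> {(I, J). let C = sub_cols A J; R = sub_rows A I; U = sub_mat A I J
               in vec_space.rank d\<^sub>1 U = k \<and> A = C * pseudoinverse U * R}"
        using cur_decomposition_factored[OF B Q AB I J] by (simp add: IJ_eq len kk Let_def)
    qed
  qed auto
  finally show ?thesis .
qed

text \<open>As \<epsilon>^4 is at most 1, the exponential is at least 1/2 and the truncated bound is
  0. The comparison of the two bounds thus reduces to nonnegativity.\<close>

lemma void_probability_bound:
  fixes \<epsilon> :: real
  assumes "0 < \<epsilon>" "\<epsilon> < 1"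
  shows "(max 0 (1 - 2 * exp (- (ln 2 / 3 * \<epsilon> ^ 4))))\<^sup>2 = (0 :: real)"
proof -
  have "\<epsilon> ^ 4 \<le> 1" using assms by (simp add: power_le_one)
  then have "ln 2 / 3 * \<epsilon> ^ 4 \<le> ln 2 * (1 :: real)"
    using assms(1) by (intro mult_mono) auto
  then have "exp (- ln 2) \<le> exp (- (ln 2 / 3 * \<epsilon> ^ 4))" by simp
  then show ?thesis by (simp add: exp_minus)
qed

theorem corollary6p5:
  shows "\<exists>C\<^sub>0 c :: real. C\<^sub>0 > 0 \<and> c > 0 \<and>
      (\<forall>(m::nat) (n::nat) (A::real mat) (E::real mat) (At::real mat) (k::nat) (r::real)
          (\<alpha>::real) (\<beta>::real) (\<epsilon>::real) (\<delta>::real) (d\<^sub>1::nat) (d\<^sub>2::nat).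
        A \<in> carrier_mat m n \<longrightarrow> E \<in> carrier_mat m n \<longrightarrow> At = A + E \<longrightarrow>
        A \<noteq> 0\<^sub>m m n \<longrightarrow>
        r = (frob_norm A)\<^sup>2 / (spectral_norm A)\<^sup>2 \<longrightarrow>
        k = vec_space.rank m A \<longrightarrow>
        \<alpha> = 1 / sqrt (real m) *
              Min {frob_norm A / vec_norm2 (row A i) | i. i < m \<and> row A i \<noteq> 0\<^sub>v n} \<longrightarrow>
        \<beta> = 1 / sqrt (real n) *
              Min {frob_norm A / vec_norm2 (col A j) | j. j < n \<and> col A j \<noteq> 0\<^sub>v m} \<longrightarrow>
        0 < \<epsilon> \<longrightarrow> \<epsilon> < 1 \<longrightarrow> 0 < \<delta> \<longrightarrow> \<delta> < 1 \<longrightarrow>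
        \<epsilon>\<^sup>2 * sqrt \<delta> / 2 < min \<alpha> \<beta> \<longrightarrow>
        \<epsilon> < singular_value A k / spectral_norm A \<longrightarrow>
        0 < d\<^sub>1 \<longrightarrow> 0 < d\<^sub>2 \<longrightarrow>
        real d\<^sub>1 \<ge> C\<^sub>0 * (r / (\<epsilon> ^ 4 * \<delta>)) * ln (r / (\<epsilon> ^ 4 * \<delta>)) \<longrightarrow>
        real d\<^sub>2 \<ge> C\<^sub>0 * (r / (\<epsilon> ^ 4 * \<delta>)) * ln (r / (\<epsilon> ^ 4 * \<delta>)) \<longrightarrow>
        measure_pmf.prob (sample_indices m n d\<^sub>1 d\<^sub>2)
          {(I, J). let C = sub_cols A J; R = sub_rows A I; U = sub_mat A I J
                   in vec_space.rank d\<^sub>1 U = k \<and> A = C * pseudoinverse U * R}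
          \<ge> max 0 (1 - 2 * exp (- (c * \<alpha>\<^sup>2 / \<delta>))) * max 0 (1 - 2 * exp (- (c * \<beta>\<^sup>2 / \<delta>))) \<and>
        max 0 (1 - 2 * exp (- (c * \<alpha>\<^sup>2 / \<delta>))) * max 0 (1 - 2 * exp (- (c * \<beta>\<^sup>2 / \<delta>)))
          \<ge> (max 0 (1 - 2 * exp (- (c * \<epsilon> ^ 4))))\<^sup>2) \<and>
      (\<forall>(m::nat) (n::nat) (A::complex mat) (E::complex mat) (At::complex mat) (k::nat) (r::real)
          (\<alpha>::real) (\<beta>::real) (\<epsilon>::real) (\<delta>::real) (d\<^sub>1::nat) (d\<^sub>2::nat).
        A \<in> carrier_mat m n \<longrightarrow> E \<in> carrier_mat m n \<longrightarrow> At = A + E \<longrightarrow>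
        A \<noteq> 0\<^sub>m m n \<longrightarrow>
        r = (frob_norm A)\<^sup>2 / (spectral_norm A)\<^sup>2 \<longrightarrow>
        k = vec_space.rank m A \<longrightarrow>
        \<alpha> = 1 / sqrt (real m) *
              Min {frob_norm A / vec_norm2 (row A i) | i. i < m \<and> row A i \<noteq> 0\<^sub>v n} \<longrightarrow>
        \<beta> = 1 / sqrt (real n) *
              Min {frob_norm A / vec_norm2 (col A j) | j. j < n \<and> col A j \<noteq> 0\<^sub>v m} \<longrightarrow>
        0 < \<epsilon> \<longrightarrow> \<epsilon> < 1 \<longrightarrow> 0 < \<delta> \<longrightarrow> \<delta> < 1 \<longrightarrow>
        \<epsilon>\<^sup>2 * sqrt \<delta> / 2 < min \<alpha> \<beta> \<longrightarrow>
        \<epsilon> < singular_value A k / spectral_norm A \<longrightarrow>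
        0 < d\<^sub>1 \<longrightarrow> 0 < d\<^sub>2 \<longrightarrow>
        real d\<^sub>1 \<ge> C\<^sub>0 * (r / (\<epsilon> ^ 4 * \<delta>)) * ln (r / (\<epsilon> ^ 4 * \<delta>)) \<longrightarrow>
        real d\<^sub>2 \<ge> C\<^sub>0 * (r / (\<epsilon> ^ 4 * \<delta>)) * ln (r / (\<epsilon> ^ 4 * \<delta>)) \<longrightarrow>
        measure_pmf.prob (sample_indices m n d\<^sub>1 d\<^sub>2)
          {(I, J). let C = sub_cols A J; R = sub_rows A I; U = sub_mat A I J
                   in vec_space.rank d\<^sub>1 U = k \<and> A = C * pseudoinverse U * R}
          \<ge> max 0 (1 - 2 * exp (- (c * \<alpha>\<^sup>2 / \<delta>))) * max 0 (1 - 2 * exp (- (c * \<beta>\<^sup>2 / \<delta>))) \<and>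
        max 0 (1 - 2 * exp (- (c * \<alpha>\<^sup>2 / \<delta>))) * max 0 (1 - 2 * exp (- (c * \<beta>\<^sup>2 / \<delta>)))
          \<ge> (max 0 (1 - 2 * exp (- (c * \<epsilon> ^ 4))))\<^sup>2)"
\<comment> \<open>The constant 2 provides t ln x twice in the tail estimate, and ln 2 / 3 comes from
  its threshold t = 3. Both fields share them, being instances of
  \<open>cur_sampling\<close>.\<close>
proof (rule exI[of _ 2], rule exI[of _ "ln 2 / 3"], intro conjI allI impI, goal_cases)
  case 1
  show ?case by simp
next
  case 2
  show ?case by simp
next
  case (3 m n A E At k r \<alpha> \<beta> \<epsilon> \<delta> d\<^sub>1 d\<^sub>2)
  show ?case
    by (rule cur_sampling[OF hermitian_splits_real 3(1,4-14,17,18)])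
next
  case (4 m n A E At k r \<alpha> \<beta> \<epsilon> \<delta> d\<^sub>1 d\<^sub>2)
  show ?case unfolding void_probability_bound[OF 4(9,10)] by simp
next
  case (5 m n A E At k r \<alpha> \<beta> \<epsilon> \<delta> d\<^sub>1 d\<^sub>2)
  show ?case
    by (rule cur_sampling[OF hermitian_splits_complex 5(1,4-14,17,18)])
next
  case (6 m n A E At k r \<alpha> \<beta> \<epsilon> \<delta> d\<^sub>1 d\<^sub>2)
  show ?case unfolding void_probability_bound[OF 6(9,10)] by simp
qed

end
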